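(* Let $G$ be a Berge graph, and let $X,Y$ be disjoint nonempty anticonnected subsets of $V(G)$ with $X$ complete to $Y$. Let $P$ be a path in $G\setminus(X\cup Y)$ of even length $>0$ with vertices $p_1,\dots,p_n$ in order, such that $p_1$ is the unique $X$-complete vertex of $P$ and $p_n$ is the unique $Y$-complete vertex of $P$. Then one of the following holds: (1) $P$ has length $\ge 4$ and there are nonadjacent $x_1,x_2\in X$ such that $x_1\hbox{-}p_2\hbox{-}\cdots\hbox{-}p_n\hbox{-}x_2$ is a path; (2) $P$ has length $\ge 4$ and there are nonadjacent $y_1,y_2\in Y$ such that $y_1\hbox{-}p_1\hbox{-}\cdots\hbox{-}p_{n-1}\hbox{-}y_2$ is a path; (3) $P$ has length $2$ and there is an antipath $Q$ between $p_2$ and $p_3$ with interior in $X$ and an antipath $R$ between $p_1$ and $p_2$ with interior in $Y$, and exactly one of $Q,R$ has odd length. In each case, either the pair $(V(P)\setminus\{p_1\},X)$ or the pair $(V(P)\setminus\{p_n\},Y)$ is not balanced.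
   Context: Graphs are finite and simple. Hole: induced cycle of length $\ge4$; antihole: induced subgraph whose complement is a hole; Berge: all holes and antiholes even. A path means an induced subgraph that is a path (writing $u_1\hbox{-}\cdots\hbox{-}u_k$ is a path means the induced subgraph on these vertices is a path with them in this order); an antipath is an induced subgraph whose complement is a path; lengths count edges (of the complement, for antipaths); the interior is the set of internal vertices. $X$ is anticonnected if $\overline{G}|X$ is connected; $X$ complete to $Y$ means every vertex of $X$ is adjacent to every vertex of $Y$; a vertex is $X$-complete if adjacent to all of $X$. For disjoint $A,B$, the pair $(A,B)$ is balanced if there is no odd path between nonadjacent vertices of $B$ with interior in $A$ and no odd antipath between adjacent vertices of $A$ with interior in $B$. *)

theory Defs
  imports Main
begin

definition simple_graph :: "'a set \<Rightarrow> ('a \<Rightarrow> 'a \<Rightarrow> bool) \<Rightarrow> bool" where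
  "simple_graph V E \<longleftrightarrow> finite V \<and> (\<forall>u v. E u v \<longrightarrow> E v u) \<and> (\<forall>v. \<not> E v v)
     \<and> (\<forall>u v. E u v \<longrightarrow> u \<in> V \<and> v \<in> V)"

definition is_path :: "'a set \<Rightarrow> ('a \<Rightarrow> 'a \<Rightarrow> bool) \<Rightarrow> 'a list \<Rightarrow> bool" where
  "is_path V E ps \<longleftrightarrow> ps \<noteq> [] \<and> distinct ps \<and> set ps \<subseteq> V \<and>
     (\<forall>i<length ps. \<forall>j<length ps. i \<noteq> j \<longrightarrow>
        (E (ps!i) (ps!j) \<longleftrightarrow> (j = i + 1 \<or> i = j + 1)))"

definition is_antipath :: "'a set \<Rightarrow> ('a \<Rightarrow> 'a \<Rightarrow> bool) \<Rightarrow> 'a list \<Rightarrow> bool" where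
  "is_antipath V E ps \<longleftrightarrow> ps \<noteq> [] \<and> distinct ps \<and> set ps \<subseteq> V \<and>
     (\<forall>i<length ps. \<forall>j<length ps. i \<noteq> j \<longrightarrow>
        (\<not> E (ps!i) (ps!j) \<longleftrightarrow> (j = i + 1 \<or> i = j + 1)))"

definition plen :: "'a list \<Rightarrow> nat" where
  "plen ps = length ps - 1"

definition interior :: "'a list \<Rightarrow> 'a set" where
  "interior ps = set (butlast (tl ps))"

definition is_hole :: "'a set \<Rightarrow> ('a \<Rightarrow> 'a \<Rightarrow> bool) \<Rightarrow> 'a list \<Rightarrow> bool" where
  "is_hole V E cs \<longleftrightarrow> length cs \<ge> 4 \<and> distinct cs \<and> set cs \<subseteq> V \<and>
     (\<forall>i<length cs. \<forall>j<length cs. i \<noteq> j \<longrightarrow>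
        (E (cs!i) (cs!j) \<longleftrightarrow> (j = Suc i mod length cs \<or> i = Suc j mod length cs)))"

definition is_antihole :: "'a set \<Rightarrow> ('a \<Rightarrow> 'a \<Rightarrow> bool) \<Rightarrow> 'a list \<Rightarrow> bool" where
  "is_antihole V E cs \<longleftrightarrow> length cs \<ge> 4 \<and> distinct cs \<and> set cs \<subseteq> V \<and>
     (\<forall>i<length cs. \<forall>j<length cs. i \<noteq> j \<longrightarrow>
        (\<not> E (cs!i) (cs!j) \<longleftrightarrow> (j = Suc i mod length cs \<or> i = Suc j mod length cs)))"

definition berge :: "'a set \<Rightarrow> ('a \<Rightarrow> 'a \<Rightarrow> bool) \<Rightarrow> bool" where
  "berge V E \<longleftrightarrow> (\<forall>cs. is_hole V E cs \<longrightarrow> even (length cs)) \<and>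
                  (\<forall>cs. is_antihole V E cs \<longrightarrow> even (length cs))"

definition anticonnected :: "('a \<Rightarrow> 'a \<Rightarrow> bool) \<Rightarrow> 'a set \<Rightarrow> bool" where
  "anticonnected E X \<longleftrightarrow> (\<forall>u\<in>X. \<forall>v\<in>X.
     (\<lambda>a b. a \<in> X \<and> b \<in> X \<and> a \<noteq> b \<and> \<not> E a b)\<^sup>*\<^sup>* u v)"

definition complete_to :: "('a \<Rightarrow> 'a \<Rightarrow> bool) \<Rightarrow> 'a set \<Rightarrow> 'a set \<Rightarrow> bool" where
  "complete_to E X Y \<longleftrightarrow> (\<forall>x\<in>X. \<forall>y\<in>Y. E x y)"

definition X_complete :: "('a \<Rightarrow> 'a \<Rightarrow> bool) \<Rightarrow> 'a set \<Rightarrow> 'a \<Rightarrow> bool" where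
  "X_complete E X v \<longleftrightarrow> (\<forall>x\<in>X. E v x)"

definition balanced :: "'a set \<Rightarrow> ('a \<Rightarrow> 'a \<Rightarrow> bool) \<Rightarrow> 'a set \<Rightarrow> 'a set \<Rightarrow> bool" where
  "balanced V E A B \<longleftrightarrow>
     \<not> (\<exists>ps. is_path V E ps \<and> hd ps \<in> B \<and> last ps \<in> B \<and> hd ps \<noteq> last ps \<and>
           \<not> E (hd ps) (last ps) \<and> interior ps \<subseteq> A \<and> odd (plen ps)) \<and>
     \<not> (\<exists>qs. is_antipath V E qs \<and> hd qs \<in> A \<and> last qs \<in> A \<and> hd qs \<noteq> last qs \<and>
           E (hd qs) (last qs) \<and> interior qs \<subseteq> B \<and> odd (plen qs))"

end

theory Submission
  imports Defs
begin

text \<open>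
  If \<open>P\<close> has three vertices, antipaths through \<open>X\<close> and through \<open>Y\<close> close up with
  \<open>p\<^sub>1, p\<^sub>2, p\<^sub>3\<close> to an antihole, whose parity gives the third outcome. For longer \<open>P\<close>, assume
  that neither leap exists and induct on \<open>card X + card Y\<close>. Closing a leap of a subpath
  with \<open>p\<^sub>1\<close> or \<open>p\<^sub>n\<close> gives an odd hole or antihole, so no subpath avoiding \<open>p\<^sub>1\<close> has a leap in \<open>X\<close>
  and none avoiding \<open>p\<^sub>n\<close> has one in \<open>Y\<close>. Append to \<open>P\<close> a virtual vertex complete to \<open>X\<close>. By induction,
  for every proper nonempty anticonnected \<open>Z\<close> in \<open>X\<close> two consecutive \<open>Z\<close>-complete vertices are then
  adjacent or at even distance, so an odd number of edges is \<open>Z\<close>-complete, whereas no edge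
  is \<open>X\<close>-complete. If \<open>X\<close> is stable, summing over all \<open>Z\<close> contradicts the parity of the number of edges
  whose ends have a common neighbour in \<open>X\<close>. Otherwise choose adjacent \<open>x1, x2\<close> in \<open>X\<close> such that deleting either
  one keeps \<open>X\<close> anticonnected, and compare the edges complete to \<open>X - {x1}\<close>, to \<open>X - {x2}\<close>
  and to \<open>X - {x1, x2}\<close>.
\<close>

section \<open>Induced paths and holes\<close>

text \<open>Antipaths are handled as paths of the non-adjacency relation. That relation is
  reflexive, so the general path lemmas below assume symmetry but never irreflexivity.\<close>

lemma is_antipath_iff: "is_antipath V E = is_path V (\<lambda>u v. \<not> E u v)"
  by (simp add: fun_eq_iff is_antipath_def is_path_def)

lemma is_antihole_iff: "is_antihole V E = is_hole V (\<lambda>u v. \<not> E u v)"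
  by (simp add: fun_eq_iff is_antihole_def is_hole_def)

lemma is_path_singleton [simp]: "is_path V E [x] \<longleftrightarrow> x \<in> V"
  by (simp add: is_path_def)

lemma is_path_Cons_Cons:
  assumes "symp E"
  shows "is_path V E (x # y # rs) \<longleftrightarrow>
    x \<in> V \<and> x \<notin> set (y # rs) \<and> E x y \<and> (\<forall>z\<in>set rs. \<not> E x z) \<and> is_path V E (y # rs)"
    (is "?L \<longleftrightarrow> ?R")
proof
  assume L: ?L
  have adj: "E ((x # y # rs) ! i) ((x # y # rs) ! j) \<longleftrightarrow> j = i + 1 \<or> i = j + 1"
    if "i < length (x # y # rs)" "j < length (x # y # rs)" "i \<noteq> j" for i j
    using L that unfolding is_path_def by blast
  have 1: "E x y" using adj[of 0 1] by simp
  have 2: "\<not> E x z" if "z \<in> set rs" for z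
  proof -
    from that obtain k where "k < length rs" "z = rs ! k" by (metis in_set_conv_nth)
    then show ?thesis using adj[of 0 "k + 2"] by simp
  qed
  have 3: "E ((y # rs) ! i) ((y # rs) ! j) \<longleftrightarrow> j = i + 1 \<or> i = j + 1"
    if "i < length (y # rs)" "j < length (y # rs)" "i \<noteq> j" for i j
    using adj[of "Suc i" "Suc j"] that by simp
  show ?R using L 1 2 3 unfolding is_path_def by auto
next
  assume R: ?R
  then have adj: "E ((y # rs) ! i) ((y # rs) ! j) \<longleftrightarrow> j = i + 1 \<or> i = j + 1"
    if "i < length (y # rs)" "j < length (y # rs)" "i \<noteq> j" for i j
    using that unfolding is_path_def by blast
  have x0: "E x ((y # rs) ! j) \<longleftrightarrow> j = 0" if "j < length (y # rs)" for j
    using R that by (cases j) auto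
  have x0': "E ((y # rs) ! j) x \<longleftrightarrow> j = 0" if "j < length (y # rs)" for j
    using x0[OF that] assms by (metis sympD)
  have "E ((x # y # rs) ! i) ((x # y # rs) ! j) \<longleftrightarrow> j = i + 1 \<or> i = j + 1"
    if "i < length (x # y # rs)" "j < length (x # y # rs)" "i \<noteq> j" for i j
  proof (cases i)
    case 0
    then have "j \<noteq> 0" using that(3) by simp
    then obtain j' where "j = Suc j'" by (metis not0_implies_Suc)
    then show ?thesis using 0 x0[of j'] that by simp
  next
    case (Suc i')
    show ?thesis
    proof (cases j)
      case 0 then show ?thesis using Suc x0'[of i'] that by simp
    next
      case (Suc j') then show ?thesis using \<open>i = Suc i'\<close> adj[of i' j'] that by simp
    qed
  qed
  with R show ?L unfolding is_path_def by auto
qed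

lemma is_path_rev:
  assumes "is_path V E ps" shows "is_path V E (rev ps)"
proof -
  have "E (rev ps ! i) (rev ps ! j) \<longleftrightarrow> j = i + 1 \<or> i = j + 1"
    if "i < length ps" "j < length ps" "i \<noteq> j" for i j
  proof -
    have "\<forall>i<length ps. \<forall>j<length ps. i \<noteq> j \<longrightarrow> (E (ps ! i) (ps ! j) \<longleftrightarrow> j = i + 1 \<or> i = j + 1)"
      using assms unfolding is_path_def by blast
    from this[rule_format, of "length ps - Suc i" "length ps - Suc j"]
    have "E (ps ! (length ps - Suc i)) (ps ! (length ps - Suc j)) \<longleftrightarrow>
      length ps - Suc j = length ps - Suc i + 1 \<or> length ps - Suc i = length ps - Suc j + 1"
      using that by linarith
    moreover have "length ps - Suc j = length ps - Suc i + 1 \<longleftrightarrow> i = j + 1"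
      "length ps - Suc i = length ps - Suc j + 1 \<longleftrightarrow> j = i + 1"
      using that by linarith+
    ultimately show ?thesis using that by (simp only: rev_nth) blast
  qed
  then show ?thesis using assms by (simp add: is_path_def)
qed

lemma is_path_rev_iff: "is_path V E (rev ps) \<longleftrightarrow> is_path V E ps"
  using is_path_rev[of V E ps] is_path_rev[of V E "rev ps"] by auto

lemma is_path_append:
  assumes "symp E" "is_path V E (xs @ [v])" "is_path V E (v # ys)"
    and "\<And>x y. x \<in> set xs \<Longrightarrow> y \<in> set ys \<Longrightarrow> x \<noteq> y \<and> \<not> E x y"
  shows "is_path V E (xs @ v # ys)"
  using assms(2,4)
proof (induction xs)
  case Nil then show ?case using assms(3) by simp
next
  case (Cons x xs)
  show ?case
  proof (cases xs)
    case Nil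
    then have "x \<in> V" "x \<noteq> v" "E x v"
      using Cons.prems(1) by (simp_all add: is_path_Cons_Cons[OF assms(1)])
    then show ?thesis using Nil Cons.prems(2)[of x] assms(3)
      by (auto simp: is_path_Cons_Cons[OF assms(1)])
  next
    case (Cons x' xs')
    have x: "x \<in> V" "x \<notin> set (xs @ [v])" "E x x'" "\<forall>z\<in>set (xs' @ [v]). \<not> E x z"
      "is_path V E (xs @ [v])"
      using Cons.prems(1) unfolding Cons by (simp_all add: is_path_Cons_Cons[OF assms(1)])
    have "is_path V E (xs @ v # ys)"
      using x(5) Cons.prems(2) by (intro Cons.IH) simp_all
    moreover have "x \<notin> set (xs @ v # ys)" "\<forall>z\<in>set (xs' @ v # ys). \<not> E x z"
      using x Cons.prems(2)[of x] by auto
    ultimately show ?thesis using x(1,3) unfolding Cons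
      by (simp add: is_path_Cons_Cons[OF assms(1)])
  qed
qed

lemma is_path_snoc:
  assumes "symp E" "is_path V E ps" "w \<in> V" "w \<notin> set ps" "E (last ps) w"
    and "\<And>u. u \<in> set (butlast ps) \<Longrightarrow> \<not> E u w"
  shows "is_path V E (ps @ [w])"
proof -
  have ne: "ps \<noteq> []" using assms(2) by (simp add: is_path_def)
  then have lV: "last ps \<in> V" using assms(2) by (auto simp: is_path_def)
  have "last ps \<noteq> w" "is_path V E [last ps, w]"
    using assms(3-5) ne lV last_in_set[OF ne] by (auto simp: is_path_Cons_Cons[OF assms(1)])
  have "is_path V E (butlast ps @ last ps # [w])"
  proof (rule is_path_append[OF assms(1)])
    show "is_path V E (butlast ps @ [last ps])" using assms(2) ne by simp
    show "is_path V E [last ps, w]" by fact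
    show "x \<noteq> y \<and> \<not> E x y" if "x \<in> set (butlast ps)" "y \<in> set [w]" for x y
      using that assms(4) assms(6)[OF that(1)] in_set_butlastD[OF that(1)] by auto
  qed
  then show ?thesis using ne
    by (metis append.assoc append_Cons append_Nil append_butlast_last_id)
qed

lemma is_path_segment:
  assumes "is_path V E P" "a < b" "b \<le> length P"
  shows "is_path V E (map ((!) P) [a..<b])"
  using assms unfolding is_path_def
  by (auto simp: distinct_map inj_on_def nth_eq_iff_index_eq)

lemma is_path_prefix:
  assumes "is_path V E (xs @ ys)" "xs \<noteq> []"
  shows "is_path V E xs"
proof -
  have "map ((!) (xs @ ys)) [0..<length xs] = xs"
    by (intro nth_equalityI) (simp_all add: nth_append)
  then show ?thesis using is_path_segment[OF assms(1), of 0 "length xs"] assms(2) by simp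
qed

lemma is_path_snocD:
  assumes "is_path V E (ps @ [w])" "p \<in> set ps"
  shows "E p w \<longleftrightarrow> p = last ps"
proof -
  from assms(2) obtain i where i: "i < length ps" "p = ps ! i" by (metis in_set_conv_nth)
  have "\<forall>i<length (ps @ [w]). \<forall>j<length (ps @ [w]). i \<noteq> j \<longrightarrow>
      (E ((ps @ [w]) ! i) ((ps @ [w]) ! j) \<longleftrightarrow> j = i + 1 \<or> i = j + 1)"
    using assms(1) unfolding is_path_def by blast
  from this[rule_format, of i "length ps"] i have "E p w \<longleftrightarrow> length ps = i + 1"
    by (simp add: nth_append)
  moreover have "last ps = ps ! (length ps - 1)" using i(1) by (intro last_conv_nth) auto
  moreover have "distinct ps" using assms(1) by (simp add: is_path_def)
  ultimately show ?thesis using i by (auto simp: nth_eq_iff_index_eq)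
qed

text \<open>The only source of holes, and via non-adjacency of antiholes, in the whole proof:
  \<open>w\<close> takes the last index, and the modulus supplies its two edges to the ends of
  \<open>ps\<close>.\<close>

lemma is_hole_snoc:
  assumes "symp E" "is_path V E ps" "length ps \<ge> 3" "w \<in> V" "w \<notin> set ps"
    and "E w (hd ps)" "E w (last ps)" and "\<And>u. u \<in> interior ps \<Longrightarrow> \<not> E w u"
  shows "is_hole V E (ps @ [w])"
proof -
  let ?m = "length ps"
  have adj: "E (ps ! i) (ps ! j) \<longleftrightarrow> j = i + 1 \<or> i = j + 1" if "i < ?m" "j < ?m" "i \<noteq> j" for i j
    using assms(2) that unfolding is_path_def by blast
  have w: "E w (ps ! i) \<longleftrightarrow> i = 0 \<or> Suc i = ?m" if "i < ?m" for i
  proof (cases "i = 0 \<or> Suc i = ?m")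
    case True
    then show ?thesis using assms(3,6,7)
      by (metis diff_Suc_1 hd_conv_nth last_conv_nth list.size(3) not_numeral_le_zero)
  next
    case False
    then have "i - 1 < length (butlast (tl ps))" "butlast (tl ps) ! (i - 1) = ps ! i"
      using that by (auto simp: nth_butlast nth_tl)
    then have "ps ! i \<in> interior ps" unfolding interior_def by (metis nth_mem)
    then show ?thesis using assms(8) False by blast
  qed
  have w': "E (ps ! i) w \<longleftrightarrow> i = 0 \<or> Suc i = ?m" if "i < ?m" for i
    using w[OF that] assms(1) by (metis sympD)
  have "E ((ps @ [w]) ! i) ((ps @ [w]) ! j) \<longleftrightarrow>
      j = Suc i mod Suc ?m \<or> i = Suc j mod Suc ?m"
    if "i < Suc ?m" "j < Suc ?m" "i \<noteq> j" for i j
  proof -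
    from that have "i < ?m \<and> j < ?m \<or> i = ?m \<and> j < ?m \<or> i < ?m \<and> j = ?m" by linarith
    then consider "i < ?m" "j < ?m" | "i = ?m" "j < ?m" | "i < ?m" "j = ?m" by blast
    then show ?thesis
    proof cases
      case 1 then show ?thesis using adj[OF 1 that(3)] by (simp add: nth_append)
    next
      case 2 then show ?thesis using w[of j] by (auto simp: nth_append)
    next
      case 3 then show ?thesis using w'[of i] by (auto simp: nth_append)
    qed
  qed
  then show ?thesis using assms(2-5) by (simp add: is_hole_def is_path_def)
qed

text \<open>The path grows along the walk. If the next vertex \<open>w\<close> already lies on it,
  the path is cut at \<open>w\<close>; otherwise it is cut at its first neighbour of
  \<open>w\<close>, so that \<open>w\<close> sees only the last vertex.\<close>

lemma induced_path_exists:
  assumes "symp F" "(\<lambda>a b. a \<in> W \<and> b \<in> W \<and> a \<noteq> b \<and> F a b)\<^sup>*\<^sup>* u v" "u \<in> W" "W \<subseteq> V"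
  shows "\<exists>ps. is_path V F ps \<and> hd ps = u \<and> last ps = v \<and> set ps \<subseteq> W"
  using assms(2)
proof (induction rule: rtranclp_induct)
  case base
  then show ?case using assms by (intro exI[of _ "[u]"]) auto
next
  case (step v w)
  then obtain ps where ps: "is_path V F ps" "hd ps = u" "last ps = v" "set ps \<subseteq> W" by blast
  have ne: "ps \<noteq> []" using ps(1) by (simp add: is_path_def)
  have prefix: "is_path V F (as @ [z])" if "ps = as @ z # bs" for as z bs
  proof -
    have "map ((!) ps) [0..<Suc (length as)] = as @ [z]"
      using that by (auto intro!: nth_equalityI simp: nth_append simp del: upt_Suc)
    then show ?thesis using is_path_segment[OF ps(1), of 0 "Suc (length as)"] that by simp
  qed
  show ?case
  proof (cases "w \<in> set ps")
    case True
    then obtain as bs where d: "ps = as @ w # bs" by (meson split_list)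
    then show ?thesis using prefix[OF d] ps ne
      by (intro exI[of _ "as @ [w]"]) (auto simp: hd_append)
  next
    case False
    have "\<exists>z\<in>set ps. F z w" using step.hyps(2) ps(3) ne by (metis last_in_set)
    then obtain as z bs where d: "ps = as @ z # bs" "F z w" "\<forall>y\<in>set as. \<not> F y w"
      using split_list_first_prop[of ps "\<lambda>z. F z w"] by auto
    then have "is_path V F ((as @ [z]) @ [w])"
      using prefix[OF d(1)] False step.hyps(2) assms(1,4) d
      by (intro is_path_snoc[OF _ prefix[OF d(1)]]) auto
    then show ?thesis using ps(2,4) d(1) step.hyps(2)
      by (intro exI[of _ "as @ [z, w]"]) (auto simp: hd_append)
  qed
qed

text \<open>The gaps between consecutive marked indices add up to \<open>n\<close>. A gap of length
  one is one counted pair, and every other gap is even; the induction takes off the last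
  gap.\<close>

lemma card_consecutive_parity:
  fixes C :: "nat \<Rightarrow> bool"
  assumes "C 0" "C n"
    and "\<And>a b. a < b \<Longrightarrow> b \<le> n \<Longrightarrow> C a \<Longrightarrow> C b \<Longrightarrow> (\<And>k. a < k \<Longrightarrow> k < b \<Longrightarrow> \<not> C k) \<Longrightarrow>
      b - a = 1 \<or> even (b - a)"
  shows "even (card {k. k < n \<and> C k \<and> C (Suc k)}) \<longleftrightarrow> even n"
  using assms(2,3)
proof (induction n rule: less_induct)
  case (less n)
  show ?case
  proof (cases "n = 0")
    case False
    define a where "a = Max {k. k < n \<and> C k}"
    have fin: "finite {k. k < n \<and> C k}" by simp
    have "{k. k < n \<and> C k} \<noteq> {}" using assms(1) False by auto
    then have a: "a < n" "C a" using Max_in[OF fin] by (auto simp: a_def)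
    have gap: "\<not> C k" if "a < k" "k < n" for k
    proof
      assume "C k"
      then have "k \<le> a" using Max_ge[OF fin, of k] \<open>k < n\<close> by (simp add: a_def)
      then show False using \<open>a < k\<close> by simp
    qed
    have IH: "even (card {k. k < a \<and> C k \<and> C (Suc k)}) \<longleftrightarrow> even a"
    proof (rule less.IH[OF a])
      show "b - c = 1 \<or> even (b - c)"
        if "c < b" "b \<le> a" "C c" "C b" "\<And>k. c < k \<Longrightarrow> k < b \<Longrightarrow> \<not> C k" for c b
        using less.prems(2)[OF that(1) _ that(3-5)] that(2) a(1) by simp
    qed
    have d: "n - a = 1 \<or> even (n - a)" using less.prems(2)[OF a(1) _ a(2) less.prems(1)] gap by auto
    show ?thesis
    proof (cases "n = Suc a")
      case True
      then have "{k. k < n \<and> C k \<and> C (Suc k)} = insert a {k. k < a \<and> C k \<and> C (Suc k)}"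
        using a less.prems(1) by (auto simp: less_Suc_eq)
      then show ?thesis using IH True by simp
    next
      case neq: False
      have "{k. k < n \<and> C k \<and> C (Suc k)} = {k. k < a \<and> C k \<and> C (Suc k)}"
      proof (intro Collect_cong iffI; elim conjE)
        fix k assume k: "k < n" "C k" "C (Suc k)"
        show "k < a \<and> C k \<and> C (Suc k)"
        proof (cases k a rule: linorder_cases)
          case less then show ?thesis using k by blast
        next
          case equal
          then have "Suc a < n" using a(1) neq by linarith
          then show ?thesis using gap[of "Suc a"] k(3) equal by blast
        next
          case greater then show ?thesis using gap[of k] k by blast
        qed
      next
        fix k assume "k < a" "C k" "C (Suc k)"
        then show "k < n \<and> C k \<and> C (Suc k)" using a(1) by simp
      qed
      moreover have "even (n - a)" using d neq by linarith
      then have "even n \<longleftrightarrow> even a" using a(1) by (simp add: even_diff_nat)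
      ultimately show ?thesis using IH by simp
    qed
  qed auto
qed

section \<open>Anticonnected sets\<close>

text \<open>The cut criterion for connectivity of the complement. If some \<open>v\<close> cannot be
  reached from \<open>u\<close>, the set reachable from \<open>u\<close> is the cut that
  fails.\<close>

lemma anticonnected_iff_cut:
  assumes "symp E"
  shows "anticonnected E X \<longleftrightarrow>
    (\<forall>K\<subseteq>X. K \<noteq> {} \<longrightarrow> K \<noteq> X \<longrightarrow> (\<exists>k\<in>K. \<exists>v\<in>X - K. \<not> E k v))" (is "?L \<longleftrightarrow> ?R")
proof
  let ?r = "\<lambda>a b. a \<in> X \<and> b \<in> X \<and> a \<noteq> b \<and> \<not> E a b"
  assume L: ?L
  show ?R
  proof (intro allI impI, rule ccontr)
    fix K assume K: "K \<subseteq> X" "K \<noteq> {}" "K \<noteq> X" and no: "\<not> (\<exists>k\<in>K. \<exists>v\<in>X - K. \<not> E k v)"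
    obtain u v where uv: "u \<in> K" "v \<in> X - K" using K by blast
    have "?r\<^sup>*\<^sup>* u v" using L uv K(1) unfolding anticonnected_def by blast
    then have "v \<in> K"
      by (induction rule: rtranclp_induct) (use uv no in blast)+
    then show False using uv by blast
  qed
next
  let ?r = "\<lambda>a b. a \<in> X \<and> b \<in> X \<and> a \<noteq> b \<and> \<not> E a b"
  assume R: ?R
  show ?L unfolding anticonnected_def
  proof (intro ballI, rule ccontr)
    fix u v assume uv: "u \<in> X" "v \<in> X" "\<not> ?r\<^sup>*\<^sup>* u v"
    define K where "K = {w \<in> X. ?r\<^sup>*\<^sup>* u w}"
    have "K \<subseteq> X" "K \<noteq> {}" "K \<noteq> X" using uv by (auto simp: K_def)
    then obtain k w where kw: "k \<in> K" "w \<in> X - K" "\<not> E k w" using R by blast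
    then have "?r\<^sup>*\<^sup>* u k" "?r k w" by (auto simp: K_def)
    then have "?r\<^sup>*\<^sup>* u w" by (rule rtranclp.rtrancl_into_rtrancl)
    then show False using kw by (auto simp: K_def)
  qed
qed

lemma anticonnected_singleton [simp]: "anticonnected E {x}"
  by (simp add: anticonnected_def)

lemma anticonnected_Un:
  assumes "symp E" "anticonnected E A" "anticonnected E B" "a \<in> A" "a \<in> B"
  shows "anticonnected E (A \<union> B)"
  unfolding anticonnected_iff_cut[OF assms(1)]
proof (intro allI impI)
  fix K assume K: "K \<subseteq> A \<union> B" "K \<noteq> {}" "K \<noteq> A \<union> B"
  have cut: "\<exists>k\<in>K. \<exists>v\<in>(A \<union> B) - K. \<not> E k v"
    if "anticonnected E C" "C \<subseteq> A \<union> B" "K \<inter> C \<noteq> {}" "\<not> C \<subseteq> K" for C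
  proof -
    have "K \<inter> C \<subseteq> C" "K \<inter> C \<noteq> C" using that by auto
    with that(1,3) have "\<exists>k\<in>K \<inter> C. \<exists>v\<in>C - K \<inter> C. \<not> E k v"
      unfolding anticonnected_iff_cut[OF assms(1)] by blast
    then obtain k v where "k \<in> K \<inter> C" "v \<in> C - K \<inter> C" "\<not> E k v" by blast
    then show ?thesis using that(2) by blast
  qed
  show "\<exists>k\<in>K. \<exists>v\<in>(A \<union> B) - K. \<not> E k v"
    using cut[of A] cut[of B] assms K by blast
qed

text \<open>A connected graph has a non-cut vertex other than \<open>a\<close>: a maximal proper
  anticonnected subset containing \<open>a\<close> can be extended by one vertex, so by maximality
  it misses only that vertex.\<close>

lemma anticonnected_remove_vertex:
  assumes "symp E" "finite X" "anticonnected E X" "a \<in> X" "X \<noteq> {a}"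
  obtains d where "d \<in> X" "d \<noteq> a" "anticonnected E (X - {d})"
proof -
  define S where "S = {K. K \<subseteq> X \<and> K \<noteq> X \<and> a \<in> K \<and> anticonnected E K}"
  have "finite S" using assms(2) by (simp add: S_def)
  moreover have "{a} \<in> S" using assms(4,5) by (simp add: S_def)
  ultimately obtain K where KS: "K \<in> S" and max: "\<forall>L\<in>S. K \<subseteq> L \<longrightarrow> K = L"
    using finite_has_maximal[of S] by auto
  then have K: "K \<subseteq> X" "K \<noteq> X" "a \<in> K" "anticonnected E K" by (auto simp: S_def)
  have "\<exists>k\<in>K. \<exists>v\<in>X - K. \<not> E k v"
    using assms(3) K unfolding anticonnected_iff_cut[OF assms(1)] by blast
  then obtain k v where kv: "k \<in> K" "v \<in> X - K" "\<not> E k v" by blast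
  have "\<not> E v k" using kv(3) assms(1) by (blast dest: sympD)
  then have "\<exists>i\<in>L. \<exists>j\<in>{k, v} - L. \<not> E i j" if "L \<subseteq> {k, v}" "L \<noteq> {}" "L \<noteq> {k, v}" for L
    using that kv by blast
  then have "anticonnected E {k, v}"
    unfolding anticonnected_iff_cut[OF assms(1)] by blast
  then have "anticonnected E (K \<union> {k, v})"
    by (rule anticonnected_Un[OF assms(1) K(4) _ kv(1)]) simp
  moreover have "K \<union> {k, v} = insert v K" using kv(1) by blast
  ultimately have ac: "anticonnected E (insert v K)" by simp
  have "insert v K \<notin> S" using max kv(2) by blast
  then have "X = insert v K" using ac K kv(2) unfolding S_def by blast
  then have "X - {v} = K" using kv by auto
  then show thesis using that[of v] K kv by (metis DiffD1 DiffD2)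
qed

text \<open>If deleting \<open>a\<close> splits the complement into \<open>D\<close> and
  \<open>D'\<close>, a vertex is spared on each side while the rest stays joined to
  \<open>a\<close>. If no deletion splits it, two adjacent vertices at distance two in the
  complement serve. The final disjunction prepares the case split on the parity of an antipath from
  \<open>x1\<close> to \<open>x2\<close>.\<close>

lemma anticonnected_nonstable_pair:
  assumes "symp E" "finite X" "anticonnected E X" and uv: "u \<in> X" "v \<in> X" "E u v"
    and irr: "\<And>x. \<not> E x x"
  obtains x1 x2 where "x1 \<in> X" "x2 \<in> X" "E x1 x2"
    "anticonnected E (X - {x1})" "anticonnected E (X - {x2})"
    "anticonnected E (X - {x1, x2}) \<or> (\<exists>z\<in>X. \<not> E z x1 \<and> \<not> E z x2)"
proof (cases "\<exists>a\<in>X. \<not> anticonnected E (X - {a})")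
  case True
  then obtain a D where a: "a \<in> X" and D: "D \<subseteq> X - {a}" "D \<noteq> {}" "D \<noteq> X - {a}"
    and cut: "\<And>k w. k \<in> D \<Longrightarrow> w \<in> X - {a} - D \<Longrightarrow> E k w"
    unfolding anticonnected_iff_cut[OF assms(1)] by blast
  define D' where "D' = X - {a} - D"
  have ac: "anticonnected E (insert a A)"
    if A: "A \<union> B = X - {a}" "A \<inter> B = {}" and AB: "\<And>k w. k \<in> A \<Longrightarrow> w \<in> B \<Longrightarrow> E k w" for A B
    unfolding anticonnected_iff_cut[OF assms(1)]
  proof (intro allI impI)
    fix K assume K: "K \<subseteq> insert a A" "K \<noteq> {}" "K \<noteq> insert a A"
    \<comment> \<open>\<open>B\<close> goes to the side of \<open>a\<close>. As \<open>A\<close> is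
      complete to \<open>B\<close>, a nonadjacent pair across this cut of \<open>X\<close> stays
      inside \<open>insert a A\<close>.\<close>
    let ?K = "if a \<in> K then K \<union> B else K"
    have "?K \<subseteq> X" "?K \<noteq> {}" "?K \<noteq> X" using K A a by auto
    then have "\<exists>k\<in>?K. \<exists>w\<in>X - ?K. \<not> E k w"
      using assms(3) unfolding anticonnected_iff_cut[OF assms(1)] by blast
    then obtain k w where kw: "k \<in> ?K" "w \<in> X - ?K" "\<not> E k w" by blast
    have AB': "E w k" if "k \<in> A" "w \<in> B" for k w
      using AB[OF that] assms(1) by (blast dest: sympD)
    show "\<exists>k\<in>K. \<exists>v\<in>insert a A - K. \<not> E k v"
    proof (cases "a \<in> K")
      case True
      then have "w \<in> A - K" using kw A by auto
      moreover have "k \<in> K" using kw True AB' calculation by auto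
      ultimately show ?thesis using kw by blast
    next
      case False
      then have "k \<in> A" "k \<in> K" using kw K by auto
      moreover have "w \<in> insert a A" using kw False A AB calculation by auto
      ultimately show ?thesis using kw False by auto
    qed
  qed
  have acD: "anticonnected E (insert a D)" using ac[of D D'] D cut by (auto simp: D'_def)
  have acD': "anticonnected E (insert a D')"
    using ac[of D' D] D cut assms(1) by (auto simp: D'_def dest: sympD)
  have fin: "finite (insert a D)" "finite (insert a D')"
    using D assms(2) by (auto simp: D'_def intro: finite_subset)
  have ne: "insert a D \<noteq> {a}" "insert a D' \<noteq> {a}" using D by (auto simp: D'_def)
  obtain d where d: "d \<in> insert a D" "d \<noteq> a" "anticonnected E (insert a D - {d})"
    using anticonnected_remove_vertex[OF assms(1) fin(1) acD _ ne(1)] by blast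
  obtain d' where d': "d' \<in> insert a D'" "d' \<noteq> a" "anticonnected E (insert a D' - {d'})"
    using anticonnected_remove_vertex[OF assms(1) fin(2) acD' _ ne(2)] by blast
  have "X - {d} = (insert a D - {d}) \<union> insert a D'"
       "X - {d'} = insert a D \<union> (insert a D' - {d'})"
       "X - {d, d'} = (insert a D - {d}) \<union> (insert a D' - {d'})"
    using d d' a D by (auto simp: D'_def)
  moreover have "anticonnected E ((insert a D - {d}) \<union> insert a D')"
    using d d' acD' by (intro anticonnected_Un[OF assms(1), of _ _ a]) auto
  moreover have "anticonnected E (insert a D \<union> (insert a D' - {d'}))"
    using d d' acD by (intro anticonnected_Un[OF assms(1), of _ _ a]) auto
  moreover have "anticonnected E ((insert a D - {d}) \<union> (insert a D' - {d'}))"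
    using d d' by (intro anticonnected_Un[OF assms(1), of _ _ a]) auto
  moreover have "d \<in> X" "d' \<in> X" "E d d'" using d d' D cut by (auto simp: D'_def)
  ultimately show thesis using that[of d d'] by simp
next
  case False
  \<comment> \<open>\<open>K\<close> contains \<open>u\<close> itself. A nonadjacent pair leaving
    \<open>K\<close> has its end \<open>k\<close> as a common non-neighbour of \<open>u\<close> and
    the other end \<open>w\<close>.\<close>
  define K where "K = {w \<in> X. \<not> E u w}"
  have "K \<subseteq> X" "K \<noteq> {}" "K \<noteq> X" using uv irr by (auto simp: K_def)
  then have "\<exists>k\<in>K. \<exists>w\<in>X - K. \<not> E k w"
    using assms(3) unfolding anticonnected_iff_cut[OF assms(1)] by blast
  then obtain k w where kw: "k \<in> K" "w \<in> X - K" "\<not> E k w" by blast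
  then have "\<not> E k u" using assms(1) by (auto simp: K_def dest: sympD)
  then show thesis using that[of u w] kw uv False by (auto simp: K_def)
qed

section \<open>Leaps\<close>

lemma symp_not: "symp E \<Longrightarrow> symp (\<lambda>u v. \<not> E u v)"
  by (auto simp: symp_def)

lemmas is_antipath_Cons_Cons = is_path_Cons_Cons[OF symp_not, folded is_antipath_iff]

lemma is_antipath_singleton [simp]: "is_antipath V E [x] \<longleftrightarrow> x \<in> V"
  by (simp add: is_antipath_def)

lemma is_antipath_rev_iff: "is_antipath V E (rev ps) \<longleftrightarrow> is_antipath V E ps"
  by (simp add: is_antipath_iff is_path_rev_iff)

text \<open>
  When \<open>R\<close> is an edge, a leap is an odd antipath between its ends (\<open>Q\<close> is only the interior);
  this absorbs the length-three case of the Roussel--Rubio lemma.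
\<close>

definition leap :: "'a set \<Rightarrow> ('a \<Rightarrow> 'a \<Rightarrow> bool) \<Rightarrow> 'a set \<Rightarrow> 'a list \<Rightarrow> bool" where
  "leap V E X R \<longleftrightarrow>
     (if length R = 2
      then \<exists>Q. set Q \<subseteq> X \<and> even (length Q) \<and> is_antipath V E (hd R # Q @ [last R])
      else \<exists>x1\<in>X. \<exists>x2\<in>X. is_path V E (x1 # R @ [x2]))"

lemma leap_mono: "leap V E Z R \<Longrightarrow> Z \<subseteq> X \<Longrightarrow> leap V E X R"
  unfolding leap_def by (cases "length R = 2") (simp; blast)+

lemma leap_rev:
  assumes "leap V E X R" "R \<noteq> []" shows "leap V E X (rev R)"
proof (cases "length R = 2")
  case True
  then obtain Q where Q: "set Q \<subseteq> X" "even (length Q)" "is_antipath V E (hd R # Q @ [last R])"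
    using assms by (auto simp: leap_def)
  have "rev (hd R # Q @ [last R]) = hd (rev R) # rev Q @ [last (rev R)]"
    using assms(2) by (simp add: hd_rev last_rev)
  then have "is_antipath V E (hd (rev R) # rev Q @ [last (rev R)])"
    using Q(3) is_antipath_rev_iff by metis
  then show ?thesis using Q True by (auto simp: leap_def intro!: exI[of _ "rev Q"])
next
  case False
  then obtain x1 x2 where x: "x1 \<in> X" "x2 \<in> X" "is_path V E (x1 # R @ [x2])"
    using assms by (auto simp: leap_def)
  then have "is_path V E (x2 # rev R @ [x1])"
    using is_path_rev_iff[of V E "x1 # R @ [x2]"] by simp
  then show ?thesis using x False by (auto simp: leap_def)
qed

text \<open>The two ends of a leap are distinct, and in the edge case an even repetition-free
  interior taken from one vertex is empty. This discards one alternative whenever the induction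
  hypothesis is applied with a singleton.\<close>

lemma not_leap_singleton:
  assumes "is_path V E R" "length R \<ge> 2"
  shows "\<not> leap V E {v} R"
proof (cases "length R = 2")
  case True
  then obtain r s where R: "R = [r, s]"
    by (metis One_nat_def Suc_1 length_0_conv length_Suc_conv)
  have "E r s" using assms(1) unfolding R is_path_def by force
  show ?thesis
  proof
    assume "leap V E {v} R"
    then obtain Q where Q: "set Q \<subseteq> {v}" "even (length Q)" "is_antipath V E (r # Q @ [s])"
      by (auto simp: leap_def R)
    have "distinct Q" using Q(3) by (simp add: is_antipath_def)
    then have "length Q \<le> 1" using card_mono[OF _ Q(1)] by (simp add: distinct_card)
    then have "Q = []" using Q(2) by (cases Q) auto
    then show False using Q(3) \<open>E r s\<close> unfolding is_antipath_def by force
  qed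
next
  case False
  then show ?thesis by (auto simp: leap_def is_path_def)
qed

section \<open>Parity constraints in Berge graphs\<close>

locale berge_graph =
  fixes V :: "'a set" and E :: "'a \<Rightarrow> 'a \<Rightarrow> bool"
  assumes simple: "simple_graph V E" and berge: "berge V E"
begin

lemma symp: "symp E"
  using simple by (auto simp: simple_graph_def symp_def)

lemma sym: "E u v \<Longrightarrow> E v u"
  using simple by (simp add: simple_graph_def)

lemma irrefl [simp]: "\<not> E v v"
  using simple by (simp add: simple_graph_def)

lemma finite_subset_V: "X \<subseteq> V \<Longrightarrow> finite X"
  using simple by (auto simp: simple_graph_def intro: finite_subset)

lemma odd_length_path_closed_by_vertex:
  assumes "is_path V E ps" "length ps \<ge> 3" "w \<in> V" "w \<notin> set ps"
    and "E w (hd ps)" "E w (last ps)" "\<And>u. u \<in> interior ps \<Longrightarrow> \<not> E w u"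
  shows "odd (length ps)"
  using is_hole_snoc[OF symp assms] berge by (auto simp: berge_def)

lemma odd_length_antipath_closed_by_vertex:
  assumes "is_antipath V E ps" "length ps \<ge> 3" "w \<in> V" "w \<notin> set ps"
    and "\<not> E w (hd ps)" "\<not> E w (last ps)" "\<And>u. u \<in> interior ps \<Longrightarrow> E w u"
  shows "odd (length ps)"
proof -
  have "is_antihole V E (ps @ [w])"
    using is_hole_snoc[OF symp_not[OF symp], of V ps w] assms
    by (simp add: is_antipath_iff is_antihole_iff)
  then show ?thesis using berge by (auto simp: berge_def)
qed

text \<open>The vertices \<open>u\<close>, \<open>A\<close>, \<open>v\<close>, \<open>B\<close> in
  cyclic order form an antihole, with two vertices besides those of \<open>A\<close> and
  \<open>B\<close>.\<close>

lemma even_length_antipath_cycle: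
  assumes A: "is_antipath V E (u # A @ [v])" and B: "is_antipath V E (v # B @ [u])"
    and ne: "A \<noteq> []" "B \<noteq> []" and AB: "\<And>a b. a \<in> set A \<Longrightarrow> b \<in> set B \<Longrightarrow> E a b"
  shows "even (length A + length B)"
proof -
  let ?F = "\<lambda>u v. \<not> E u v"
  have sF: "symp ?F" by (rule symp_not[OF symp])
  \<comment> \<open>\<open>w\<close> is the last vertex of \<open>B\<close>, next to
    \<open>u\<close> on the cycle. Its other neighbour \<open>y\<close> there is \<open>v\<close>
    when \<open>B\<close> has only one vertex. Without \<open>w\<close> the cycle is an antipath,
    which \<open>w\<close> closes.\<close>
  obtain w C where C: "rev B = w # C" using ne(2) by (metis list.exhaust rev_is_Nil_conv)
  obtain y zs where y: "C @ [v] = y # zs" by (cases "C @ [v]") auto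
  then have vC: "v # rev C = rev zs @ [y]" by (metis rev.simps(2) rev_append append_Cons append_Nil rev_singleton_conv rev_rev_ident)
  have "rev (v # B @ [u]) = u # w # y # zs" using C y by simp
  then have "is_path V ?F (u # w # y # zs)" using B is_path_rev unfolding is_antipath_iff by metis
  then have u: "u \<notin> set (w # y # zs)" "\<not> E u w" "\<forall>z\<in>set (y # zs). E u z"
    and w: "w \<in> V" "w \<notin> set (y # zs)" "\<not> E w y" "\<forall>z\<in>set zs. E w z"
    and "is_path V ?F (y # zs)"
    by (simp_all add: is_path_Cons_Cons[OF sF])
  then have vCp: "is_path V ?F (v # rev C)" using is_path_rev vC by (metis rev.simps(2))
  have setB: "set B = insert w (set C)" using C by (metis set_rev list.simps(15))
  have "is_path V ?F ((u # A) @ v # rev C)"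
  proof (rule is_path_append[OF sF _ vCp])
    show "is_path V ?F ((u # A) @ [v])" using A by (simp add: is_antipath_iff)
    fix a c assume a: "a \<in> set (u # A)" and c: "c \<in> set (rev C)"
    have "c \<in> set (y # zs)" using c y by (metis Un_iff set_append set_rev)
    then have "E a c" using a c u AB setB by auto
    then show "a \<noteq> c \<and> \<not> \<not> E a c" by auto
  qed
  then have p: "is_path V ?F (u # A @ rev zs @ [y])" unfolding vC by simp
  have "odd (length (u # A @ rev zs @ [y]))"
  proof (rule odd_length_antipath_closed_by_vertex[of _ w])
    show "is_antipath V E (u # A @ rev zs @ [y])" using p by (simp add: is_antipath_iff)
    show "length (u # A @ rev zs @ [y]) \<ge> 3" using ne(1) by (cases A) auto
    have "w \<notin> set A" using AB[of w w] setB by auto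
    then show "w \<notin> set (u # A @ rev zs @ [y])" using u w by auto
    show "\<not> E w (hd (u # A @ rev zs @ [y]))" using u(2) sym by auto
    show "\<not> E w (last (u # A @ rev zs @ [y]))" using w by simp
    show "E w x" if "x \<in> interior (u # A @ rev zs @ [y])" for x
    proof -
      have "x \<in> set A \<or> x \<in> set zs" using that by (simp add: interior_def butlast_append)
      then show ?thesis using w(4) AB[of x w] setB sym by auto
    qed
  qed (rule w(1))
  moreover have "length B = Suc (length zs)"
    using arg_cong[OF C, of length] arg_cong[OF y, of length] by simp
  ultimately show ?thesis by simp
qed

text \<open>A vertex complete to \<open>X\<close> with no neighbour on \<open>R\<close> would close
  the leap to an odd hole or, in the edge case, to an odd antihole.\<close>

lemma leap_neighbour:
  assumes "is_path V E R" "length R \<ge> 2" "even (length R)" "leap V E X R"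
    and "v \<in> V" "v \<notin> set R" "v \<notin> X" "X_complete E X v"
  shows "\<exists>r\<in>set R. E v r"
proof (rule ccontr)
  assume no: "\<not> (\<exists>r\<in>set R. E v r)"
  show False
  proof (cases "length R = 2")
    case True
    then obtain r s where R: "R = [r, s]"
      by (metis One_nat_def Suc_1 length_0_conv length_Suc_conv)
    have rs: "E r s" using assms(1) unfolding R is_path_def by force
    obtain Q where Q: "set Q \<subseteq> X" "even (length Q)" "is_antipath V E (r # Q @ [s])"
      using assms(4) by (auto simp: leap_def R)
    have "Q \<noteq> []" using Q(3) rs unfolding is_antipath_def by force
    then have "length (r # Q @ [s]) \<ge> 3" by (cases Q) auto
    then have "odd (length (r # Q @ [s]))"
      using assms(5-8) Q no
      by (intro odd_length_antipath_closed_by_vertex[of _ v])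
        (auto simp: R interior_def X_complete_def)
    then show False using Q(2) by simp
  next
    case False
    then obtain x1 x2 where x: "x1 \<in> X" "x2 \<in> X" "is_path V E (x1 # R @ [x2])"
      using assms(4) by (auto simp: leap_def)
    have "length (x1 # R @ [x2]) \<ge> 3" using assms(2) by simp
    then have "odd (length (x1 # R @ [x2]))"
      using assms(5-8) x no
      by (intro odd_length_path_closed_by_vertex[of _ v])
        (auto simp: interior_def X_complete_def)
    then show False using assms(3) by simp
  qed
qed

text \<open>In the complement, non-neighbours of \<open>u\<close> and of \<open>v\<close> are joined
  inside \<open>X\<close>; the walk from \<open>u\<close> to \<open>v\<close> is shortened to an
  induced path, whose interior is nonempty because \<open>u\<close> and \<open>v\<close> are
  adjacent.\<close>

lemma antipath_through_anticonnected:
  assumes "anticonnected E X" "X \<subseteq> V" "u \<in> V - X" "v \<in> V - X" "E u v"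
    and "\<not> X_complete E X u" "\<not> X_complete E X v"
  obtains Q where "set Q \<subseteq> X" "Q \<noteq> []" "is_antipath V E (u # Q @ [v])"
proof -
  let ?W = "insert u (insert v X)"
  let ?r = "\<lambda>a b. a \<in> ?W \<and> b \<in> ?W \<and> a \<noteq> b \<and> \<not> E a b"
  obtain x x' where x: "x \<in> X" "\<not> E u x" "x' \<in> X" "\<not> E v x'"
    using assms(6,7) by (auto simp: X_complete_def)
  have "?r u x" using x assms(3) by auto
  moreover have "?r\<^sup>*\<^sup>* x x'"
  proof (rule rtranclp_mono[THEN predicate2D])
    show "(\<lambda>a b. a \<in> X \<and> b \<in> X \<and> a \<noteq> b \<and> \<not> E a b)\<^sup>*\<^sup>* x x'"
      using assms(1) x unfolding anticonnected_def by blast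
  qed auto
  moreover have "?r x' v" using x assms(4) sym by auto
  ultimately have "?r\<^sup>*\<^sup>* u v"
    by (rule converse_rtranclp_into_rtranclp[of ?r u x v, OF _ rtranclp.rtrancl_into_rtrancl])
  then obtain ps where ps: "is_antipath V E ps" "hd ps = u" "last ps = v" "set ps \<subseteq> ?W"
    using induced_path_exists[OF symp_not[OF symp], of ?W u v V] assms(2-4)
    unfolding is_antipath_iff by auto
  have uv: "u \<noteq> v" using assms(5) by auto
  obtain Q where Q: "ps = u # Q @ [v]"
    using ps uv unfolding is_antipath_def
    by (metis append_butlast_last_id hd_Cons_tl last_ConsL last_tl list.sel(2))
  have "set Q \<subseteq> X" using ps(1,4) unfolding Q is_antipath_def by auto
  moreover have "Q \<noteq> []" using ps(1) assms(5) unfolding Q is_antipath_def by force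
  ultimately show thesis using that[of Q] ps(1) Q by simp
qed

end

definition segment :: "'a list \<Rightarrow> nat \<Rightarrow> nat \<Rightarrow> 'a list" where
  "segment P a b = map ((!) P) [a..<b]"

lemma length_segment [simp]: "length (segment P a b) = b - a"
  by (simp add: segment_def)

lemma set_segment: "set (segment P a b) = (!) P ` {a..<b}"
  by (simp add: segment_def)

lemma hd_segment: "a < b \<Longrightarrow> hd (segment P a b) = P ! a"
  by (simp add: segment_def hd_map)

lemma last_segment: "a < b \<Longrightarrow> last (segment P a b) = P ! (b - 1)"
  by (simp add: segment_def last_map)

lemma tl_segment: "tl (segment P a b) = segment P (Suc a) b"
  by (cases "a < b") (simp_all add: segment_def upt_conv_Cons)

lemma butlast_segment: "butlast (segment P a b) = segment P a (b - 1)"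
  by (cases b) (simp_all add: segment_def butlast_append)

lemma segment_all: "segment P 0 (length P) = P"
  by (simp add: segment_def map_nth)

section \<open>Configurations and the transfer of leaps\<close>

context berge_graph
begin

text \<open>The situation of the theorem, with even positive length counted in vertices.
  Nonemptiness of \<open>X\<close> and \<open>Y\<close> is encoded in the uniqueness of the complete
  vertices, since every vertex is complete to the empty set.\<close>

definition configuration :: "'a set \<Rightarrow> 'a set \<Rightarrow> 'a list \<Rightarrow> bool" where
  "configuration X Y P \<longleftrightarrow> X \<subseteq> V \<and> Y \<subseteq> V \<and> anticonnected E X \<and> anticonnected E Y \<and>
     complete_to E X Y \<and> is_path V E P \<and> set P \<inter> (X \<union> Y) = {} \<and>
     odd (length P) \<and> 3 \<le> length P \<and>
     (\<forall>p\<in>set P. X_complete E X p \<longleftrightarrow> p = hd P) \<and>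
     (\<forall>p\<in>set P. X_complete E Y p \<longleftrightarrow> p = last P)"

lemma complete_to_sym: "complete_to E X Y \<Longrightarrow> complete_to E Y X"
  using sym by (auto simp: complete_to_def)

lemma configuration_rev:
  assumes "configuration X Y P" shows "configuration Y X (rev P)"
proof -
  have "P \<noteq> []" using assms by (auto simp: configuration_def)
  then show ?thesis using assms complete_to_sym[of X Y] is_path_rev[of V E P]
    unfolding configuration_def by (simp add: hd_rev last_rev Un_commute)
qed

text \<open>For an edge, antipaths through \<open>X\<close> and through \<open>Y\<close> close up to
  an antihole and hence agree in parity. For longer \<open>R\<close>, the path \<open>x1 # R\<close>
  forms a configuration with \<open>Y\<close> and \<open>{x2}\<close>: \<open>x1\<close> is its only
  \<open>Y\<close>-complete vertex and the last vertex of \<open>R\<close> its only neighbour of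
  \<open>x2\<close>. The induction hypothesis leaves only a leap in \<open>Y\<close>, since a
  singleton has none.\<close>

lemma leap_transfer:
  assumes IH: "\<And>X' Y' P'. configuration X' Y' P' \<Longrightarrow> card X' + card Y' < card X + card Y \<Longrightarrow>
      leap V E X' (tl P') \<or> leap V E Y' (butlast P')"
    and XV: "X \<subseteq> V" and YV: "Y \<subseteq> V" and Yac: "anticonnected E Y" and XY: "complete_to E X Y"
    and R: "is_path V E R" "length R \<ge> 2" "even (length R)" "set R \<inter> (X \<union> Y) = {}"
    and leap: "leap V E X R" and RY: "\<And>r. r \<in> set R \<Longrightarrow> \<not> X_complete E Y r"
  shows "leap V E Y R"
proof (cases "length R = 2")
  case True
  then obtain r s where rs: "R = [r, s]"
    by (metis One_nat_def Suc_1 length_0_conv length_Suc_conv)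
  have E: "E r s" using R(1) unfolding rs is_path_def by force
  obtain A where A: "set A \<subseteq> X" "even (length A)" "is_antipath V E (r # A @ [s])"
    using leap by (auto simp: leap_def rs)
  have "A \<noteq> []" using A(3) E unfolding is_antipath_def by force
  have "r \<in> V - Y" "s \<in> V - Y" using R(1,4) by (auto simp: rs is_path_def)
  then obtain B where B: "set B \<subseteq> Y" "B \<noteq> []" "is_antipath V E (s # B @ [r])"
    using antipath_through_anticonnected[OF Yac YV, of s r] sym[OF E] RY rs by auto
  have "even (length A + length B)"
    using even_length_antipath_cycle[OF A(3) B(3) \<open>A \<noteq> []\<close> B(2)] XY A(1) B(1)
    by (auto simp: complete_to_def)
  moreover have "is_antipath V E (r # rev B @ [s])"
    using B(3) is_antipath_rev_iff[of V E "s # B @ [r]"] by simp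
  ultimately show ?thesis using A(2) B(1) by (auto simp: leap_def rs intro!: exI[of _ "rev B"])
next
  case False
  then obtain x1 x2 where x: "x1 \<in> X" "x2 \<in> X" "is_path V E (x1 # R @ [x2])"
    using leap by (auto simp: leap_def)
  have ne: "x1 \<noteq> x2" "R \<noteq> []" "x1 \<notin> set R" using x(3) R(2) by (auto simp: is_path_def)
  have fin: "finite X" using finite_subset_V[OF XV] .
  have "2 \<le> card X" using card_mono[OF fin, of "{x1, x2}"] x ne by simp
  then have less: "card Y + card {x2} < card X + card Y" by simp
  have "is_path V E (x1 # R)" using is_path_prefix[of V E "x1 # R" "[x2]"] x(3) by simp
  moreover have "E p x2 \<longleftrightarrow> p = last (x1 # R)" if "p \<in> set (x1 # R)" for p
    using is_path_snocD[of V E "x1 # R" x2 p] x(3) that by simp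
  moreover have "X_complete E Y x1" using XY x(1) by (auto simp: complete_to_def X_complete_def)
  moreover have "x1 \<notin> Y" "x2 \<notin> Y" using XY x(1,2) by (metis complete_to_def irrefl)+
  moreover have "x2 \<in> V" "x2 \<notin> set R" using x XV R(4) by auto
  moreover have "complete_to E Y {x2}" using XY x(2) sym by (auto simp: complete_to_def)
  ultimately have "configuration Y {x2} (x1 # R)"
    unfolding configuration_def using R YV Yac ne RY by (auto simp: X_complete_def[of E "{x2}"])
  from IH[OF this less] have "leap V E Y R \<or> leap V E {x2} (x1 # butlast R)"
    using ne(2) by simp
  moreover have "is_path V E (x1 # butlast R)"
    using is_path_prefix[of V E "x1 # butlast R" "[last R, x2]"] x(3) ne(2)
    by (metis append_Cons append_butlast_last_id append.assoc append_Nil list.distinct(1))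
  ultimately show ?thesis using not_leap_singleton R(2) by force
qed

end

text \<open>A counterexample minimising \<open>card X + card Y\<close>. Reversing \<open>P\<close>
  exchanges \<open>X\<close> and \<open>Y\<close>, so \<open>card2\<close> merely fixes which of the
  two sets is not a singleton.\<close>

locale leapless_configuration = berge_graph V E for V :: "'a set" and E +
  fixes X Y :: "'a set" and P :: "'a list"
  assumes cfg: "configuration X Y P"
    and IH: "\<And>X' Y' P'. configuration X' Y' P' \<Longrightarrow> card X' + card Y' < card X + card Y \<Longrightarrow>
      leap V E X' (tl P') \<or> leap V E Y' (butlast P')"
    and no_leap_tl: "\<not> leap V E X (tl P)"
    and no_leap_butlast: "\<not> leap V E Y (butlast P)"
    and len5: "5 \<le> length P"
    and card2: "2 \<le> card X"
begin

abbreviation "n \<equiv> length P"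

lemma P_ne [simp]: "P \<noteq> []"
  using len5 by auto

lemma XV: "X \<subseteq> V" and YV: "Y \<subseteq> V" and Xac: "anticonnected E X" and Yac: "anticonnected E Y"
  and XY: "complete_to E X Y" and path: "is_path V E P" and disj: "set P \<inter> (X \<union> Y) = {}"
  and odd_n: "odd n" and dist: "distinct P" and PV: "set P \<subseteq> V"
  using cfg by (auto simp: configuration_def is_path_def)

lemma adj: "i < n \<Longrightarrow> j < n \<Longrightarrow> E (P ! i) (P ! j) \<longleftrightarrow> j = i + 1 \<or> i = j + 1"
  using path unfolding is_path_def by (cases "i = j") auto

lemma nth_eq: "i < n \<Longrightarrow> j < n \<Longrightarrow> P ! i = P ! j \<longleftrightarrow> i = j"
  using dist by (simp add: nth_eq_iff_index_eq)

lemma X_complete_nth: "k < n \<Longrightarrow> X_complete E X (P ! k) \<longleftrightarrow> k = 0"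
proof -
  assume k: "k < n"
  have "hd P = P ! 0" using len5 by (intro hd_conv_nth) auto
  then show ?thesis using cfg k nth_eq[of k 0] len5 by (simp add: configuration_def)
qed

lemma Y_complete_nth: "k < n \<Longrightarrow> X_complete E Y (P ! k) \<longleftrightarrow> k = n - 1"
proof -
  assume k: "k < n"
  have "last P = P ! (n - 1)" using len5 by (intro last_conv_nth) auto
  then show ?thesis using cfg k nth_eq[of k "n - 1"] len5 by (simp add: configuration_def)
qed

lemma nth_notin: "k < n \<Longrightarrow> P ! k \<notin> X \<and> P ! k \<notin> Y \<and> P ! k \<in> V"
  using disj PV nth_mem[of k P] by blast

lemma finX: "finite X" and finY: "finite Y"
  using XV YV finite_subset_V by auto

lemma card_Y: "card Y \<ge> 1"
proof -
  have "Y \<noteq> {}" using Y_complete_nth[of 0] len5 by (auto simp: X_complete_def)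
  then show ?thesis using finY by (simp add: Suc_le_eq card_gt_0_iff)
qed

lemma segment_facts:
  assumes "a < b" "b \<le> n"
  shows "is_path V E (segment P a b)" "set (segment P a b) \<inter> (X \<union> Y) = {}"
proof -
  show "is_path V E (segment P a b)"
    using is_path_segment[OF path assms] by (simp add: segment_def)
  show "set (segment P a b) \<inter> (X \<union> Y) = {}"
    using nth_notin assms by (force simp: set_segment)
qed

lemma leap_neighbour_segment:
  assumes "a < b" "b \<le> n" "even (b - a)" "leap V E Z (segment P a b)" "k < n"
    and "X_complete E Z (P ! k)" "k < a \<or> b \<le> k"  "Z = X \<or> Z = Y"
  shows "Suc k = a \<or> k = b"
proof -
  have "2 \<le> b - a" using assms(1,3) by presburger
  moreover have "P ! k \<notin> set (segment P a b)"
    using assms(2,5,7) nth_eq by (auto simp: set_segment)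
  ultimately have "\<exists>r\<in>set (segment P a b). E (P ! k) r"
    using leap_neighbour[OF segment_facts(1)[OF assms(1,2)], of Z "P ! k"] assms nth_notin[of k]
    by auto
  then obtain i where "a \<le> i" "i < b" "E (P ! k) (P ! i)" by (auto simp: set_segment)
  then show ?thesis using adj[of k i] assms by auto
qed

text \<open>The \<open>X\<close>-complete vertex \<open>P ! 0\<close> must have a neighbour on the
  segment, so the segment starts at index 1. It is not the whole tail of \<open>P\<close>, so its
  leap transfers to \<open>Y\<close>, and then it is too far from the \<open>Y\<close>-complete last
  vertex.\<close>

lemma no_leap_X:
  assumes ab: "1 \<le> a" "a < b" "b \<le> n" "even (b - a)"
  shows "\<not> leap V E X (segment P a b)"
proof
  assume leap: "leap V E X (segment P a b)"
  have "a = 1"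
    using leap_neighbour_segment[OF ab(2-4) leap, of 0] X_complete_nth[of 0] ab len5 by auto
  moreover have "tl P = segment P 1 n" using tl_segment[of P 0 n] by (simp add: segment_all)
  ultimately have "b < n" using leap no_leap_tl ab(3) by (cases "b = n") auto
  \<comment> \<open>\<open>b\<close> and \<open>n\<close> are both odd, so an index lies strictly
    between the segment and \<open>n - 1\<close>.\<close>
  then have b: "b < n - 1" using ab(4) odd_n \<open>a = 1\<close> ab(2) by presburger
  have "leap V E Y (segment P a b)"
  proof (rule leap_transfer[OF IH XV YV Yac XY segment_facts(1) _ _ segment_facts(2) leap])
    show "\<not> X_complete E Y r" if "r \<in> set (segment P a b)" for r
      using that Y_complete_nth b by (auto simp: set_segment)
    show "2 \<le> length (segment P a b)" using ab(2,4) by simp presburger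
  qed (use ab in auto)
  from leap_neighbour_segment[OF ab(2-4) this, of "n - 1"] show False
    using Y_complete_nth[of "n - 1"] b \<open>a = 1\<close> len5 by auto
qed

text \<open>The mirror argument: the segment must end just before the last vertex and starts beyond
  index 1, so the leap transfers to \<open>X\<close>, where \<open>no_leap_X\<close> excludes
  it.\<close>

lemma no_leap_Y:
  assumes ab: "a < b" "b < n" "even (b - a)"
  shows "\<not> leap V E Y (segment P a b)"
proof
  assume leap: "leap V E Y (segment P a b)"
  have bn: "b \<le> n" using ab by simp
  have "b \<le> n - 1" using ab(2) by linarith
  then have b: "b = n - 1"
    using leap_neighbour_segment[OF ab(1) bn ab(3) leap, of "n - 1"] Y_complete_nth[of "n - 1"]
      ab len5 by auto
  moreover have "butlast P = segment P 0 (n - 1)"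
    using butlast_segment[of P 0 n] by (simp add: segment_all)
  ultimately have "a \<noteq> 0" using leap no_leap_butlast by metis
  then have a: "1 < a" using ab b odd_n by presburger
  have IH': "leap V E X' (tl P') \<or> leap V E Y' (butlast P')"
    if "configuration X' Y' P'" "card X' + card Y' < card Y + card X" for X' Y' P'
    using IH[OF that(1)] that(2) by simp
  have "leap V E X (segment P a b)"
  proof (rule leap_transfer[OF IH' YV XV Xac complete_to_sym[OF XY] segment_facts(1) _ _ _ leap])
    show "\<not> X_complete E X r" if "r \<in> set (segment P a b)" for r
      using that X_complete_nth a ab by (auto simp: set_segment)
    show "2 \<le> length (segment P a b)" using ab(1,3) by simp presburger
    show "set (segment P a b) \<inter> (Y \<union> X) = {}" using segment_facts(2)[of a b] ab by auto
  qed (use ab in auto)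
  then show False using no_leap_X[of a b] a ab by simp
qed

text \<open>The index \<open>n\<close>, one past the end of \<open>P\<close>, plays the role of a virtual vertex complete to \<open>X\<close>.\<close>

definition nb :: "nat \<Rightarrow> 'a set" where
  "nb k = (if k < n then {x \<in> X. E (P ! k) x} else X)"

lemma nb_subset: "nb k \<subseteq> X" and nb_0: "nb 0 = X" and nb_n: "nb n = X"
  using X_complete_nth[of 0] len5 by (auto simp: nb_def X_complete_def)

lemma nb_iff: "k < n \<Longrightarrow> Z \<subseteq> X \<Longrightarrow> X_complete E Z (P ! k) \<longleftrightarrow> Z \<subseteq> nb k"
  by (auto simp: nb_def X_complete_def)

lemma nb_neq: "0 < k \<Longrightarrow> k < n \<Longrightarrow> nb k \<noteq> X"
  using nb_iff[of k X] X_complete_nth[of k] by auto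

text \<open>An odd gap of length at least three would make the segment from \<open>a\<close> to
  \<open>b - 1\<close> a smaller configuration, with \<open>Z\<close> and, as second set, the
  singleton \<open>{P ! b}\<close>, or \<open>Y\<close> if \<open>b\<close> is the virtual index.
  The leap given by the induction hypothesis is excluded in each case.\<close>

lemma gap:
  assumes Z: "Z \<subset> X" "anticonnected E Z" and ab: "a < b" "b \<le> n"
    and C: "Z \<subseteq> nb a" "Z \<subseteq> nb b" "\<And>k. a < k \<Longrightarrow> k < b \<Longrightarrow> \<not> Z \<subseteq> nb k"
  shows "b - a = 1 \<or> even (b - a)"
proof (rule ccontr)
  assume neg: "\<not> (b - a = 1 \<or> even (b - a))"
  then have odd: "odd (b - a)" and b3: "3 \<le> b - a" by presburger+
  let ?R = "segment P a b"
  have R: "is_path V E ?R" "set ?R \<inter> (X \<union> Y) = {}" using segment_facts[OF ab] by auto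
  have hdR: "hd ?R = P ! a" and lastR: "last ?R = P ! (b - 1)"
    using hd_segment last_segment ab by auto
  have RZ: "\<forall>p\<in>set ?R. X_complete E Z p \<longleftrightarrow> p = hd ?R"
  proof
    fix p assume "p \<in> set ?R"
    then obtain k where k: "p = P ! k" "a \<le> k" "k < b" by (auto simp: set_segment)
    then have "Z \<subseteq> nb k \<longleftrightarrow> k = a" using C by (cases "k = a") auto
    then show "X_complete E Z p \<longleftrightarrow> p = hd ?R"
      using nb_iff[of k Z] nth_eq[of k a] k ab Z by (auto simp: hdR)
  qed
  have no1: "\<not> leap V E Z (tl ?R)"
  proof -
    have "Suc a < b" "even (b - Suc a)" using b3 odd by presburger+
    then show ?thesis
      using no_leap_X[of "Suc a" b] leap_mono[of V E Z _ X] Z(1) ab by (auto simp: tl_segment)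
  qed
  have cZ: "card Z < card X" using Z finX by (simp add: psubset_card_mono)
  show False
  proof (cases "b < n")
    case True
    have "P ! b \<notin> set ?R" using nth_eq True by (auto simp: set_segment)
    moreover have "\<forall>p\<in>set ?R. X_complete E {P ! b} p \<longleftrightarrow> p = last ?R"
    proof
      fix p assume "p \<in> set ?R"
      then obtain k where k: "p = P ! k" "a \<le> k" "k < b" by (auto simp: set_segment)
      then show "X_complete E {P ! b} p \<longleftrightarrow> p = last ?R"
        using adj[of k b] True nth_eq[of k "b - 1"] by (auto simp: lastR X_complete_def)
    qed
    moreover have "complete_to E Z {P ! b}"
      using C(2) True by (auto simp: complete_to_def nb_def dest: sym)
    ultimately have "configuration Z {P ! b} ?R"
      unfolding configuration_def using R RZ Z XV nth_notin[OF True] odd b3 by auto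
    moreover have "card Z + card {P ! b} < card X + card Y" using cZ card_Y by simp
    ultimately have "leap V E {P ! b} (butlast ?R)" using IH no1 by blast
    moreover have "\<not> leap V E {P ! b} (butlast ?R)"
      unfolding butlast_segment using ab b3 True
      by (intro not_leap_singleton segment_facts(1)) auto
    ultimately show False by simp
  next
    case False
    then have bn: "b = n" using ab by simp
    have "\<forall>p\<in>set ?R. X_complete E Y p \<longleftrightarrow> p = last ?R"
    proof
      fix p assume "p \<in> set ?R"
      then obtain k where k: "p = P ! k" "a \<le> k" "k < b" by (auto simp: set_segment)
      then show "X_complete E Y p \<longleftrightarrow> p = last ?R"
        using Y_complete_nth[of k] nth_eq[of k "n - 1"] by (auto simp: lastR[unfolded bn] bn)
    qed
    moreover have "complete_to E Z Y" using XY Z by (auto simp: complete_to_def)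
    ultimately have "configuration Z Y ?R"
      unfolding configuration_def using R RZ Z XV YV Yac odd b3 by auto
    then have "leap V E Y (butlast ?R)" using IH[of Z Y ?R] no1 cZ by simp
    moreover have "\<not> leap V E Y (butlast ?R)"
      unfolding butlast_segment using ab b3 odd bn by (intro no_leap_Y) auto
    ultimately show False by simp
  qed
qed

text \<open>The index \<open>k\<close> stands for the edge joining \<open>P ! k\<close> to its successor, possibly the virtual vertex.\<close>

definition edges :: "'a set \<Rightarrow> nat set" where
  "edges Z = {k. k < n \<and> Z \<subseteq> nb k \<and> Z \<subseteq> nb (Suc k)}"

lemma finite_edges: "finite (edges Z)"
  by (simp add: edges_def)

text \<open>Both \<open>0\<close> and the virtual index \<open>n\<close> are
  \<open>Z\<close>-complete, the gaps between are of length one or even, and \<open>n\<close> is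
  odd.\<close>

lemma odd_card_edges:
  assumes "Z \<subset> X" "anticonnected E Z"
  shows "odd (card (edges Z))"
proof -
  have "even (card {k. k < n \<and> Z \<subseteq> nb k \<and> Z \<subseteq> nb (Suc k)}) \<longleftrightarrow> even n"
    using assms gap[OF assms] by (intro card_consecutive_parity) (auto simp: nb_0 nb_n)
  then show ?thesis using odd_n by (simp add: edges_def)
qed

lemma edges_X: "edges X = {}"
proof -
  have False if "k < n" "X \<subseteq> nb k" "X \<subseteq> nb (Suc k)" for k
  proof -
    have "nb k = X" "nb (Suc k) = X" using that nb_subset by blast+
    then have "k = 0" "Suc k = n"
      using nb_neq that(1) by (metis gr0I, metis Suc_lessI zero_less_Suc)
    then show False using len5 by simp
  qed
  then show ?thesis by (auto simp: edges_def)
qed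

end

section \<open>The counting argument\<close>

context leapless_configuration
begin

text \<open>In a stable \<open>X\<close> every subset is anticonnected, so each of the evenly many
  proper nonempty subsets has an odd number of complete edges, while \<open>X\<close> itself has
  none. The sum is therefore even, against the odd number of edges whose ends share a neighbour in
  \<open>X\<close>.\<close>

lemma not_stable: "\<exists>u\<in>X. \<exists>v\<in>X. E u v"
proof (rule ccontr)
  assume "\<not> ?thesis"
  then have stable: "\<And>u v. u \<in> X \<Longrightarrow> v \<in> X \<Longrightarrow> \<not> E u v" by blast
  have ac: "anticonnected E Z" if "Z \<subseteq> X" for Z
    unfolding anticonnected_def
  proof (intro ballI)
    fix u v assume "u \<in> Z" "v \<in> Z"
    then show "(\<lambda>a b. a \<in> Z \<and> b \<in> Z \<and> a \<noteq> b \<and> \<not> E a b)\<^sup>*\<^sup>* u v"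
      using stable[of u v] that by (cases "u = v") (auto intro: r_into_rtranclp)
  qed
  have sing: "{x} \<subset> X" if "x \<in> X" for x
    using that card2 by (auto simp: psubset_eq)
  define D where "D k = nb k \<inter> nb (Suc k)" for k
  \<comment> \<open>A common neighbour \<open>x\<close> reduces this to \<open>gap\<close> for
    \<open>{x}\<close>. Otherwise private neighbours of the two ends turn the segment from
    \<open>a\<close> to \<open>b\<close> into a leap whenever \<open>b - a\<close> is odd.\<close>
  have labelled_gap: "(b - a = 1 \<and> nb a \<inter> nb b \<noteq> {}) \<or> even (b - a)"
    if ab: "a < b" "b \<le> n" "nb a \<noteq> {}" "nb b \<noteq> {}"
      and none: "\<And>k. a < k \<Longrightarrow> k < b \<Longrightarrow> nb k = {}" for a b
  proof (cases "nb a \<inter> nb b = {}")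
    case False
    then obtain x where x: "x \<in> nb a" "x \<in> nb b" by blast
    then have "x \<in> X" using nb_subset by blast
    then have "b - a = 1 \<or> even (b - a)"
      using gap[of "{x}" a b] sing ac[of "{x}"] ab x none by auto
    then show ?thesis using False by blast
  next
    case True
    then obtain x x' where x: "x \<in> nb a" "x \<notin> nb b" "x' \<in> nb b" "x' \<notin> nb a"
      using ab by blast
    then have xX: "x \<in> X" "x' \<in> X" using nb_subset by blast+
    \<comment> \<open>\<open>nb\<close> is all of \<open>X\<close> at both extreme indices, so
      private neighbours force \<open>a\<close> and \<open>b\<close> to be interior.\<close>
    have a: "1 \<le> a" using x xX nb_0 by (cases a) auto
    have b: "b < n" using x xX nb_n ab(2) by (cases "b = n") auto
    have iff: "E (P ! k) z \<longleftrightarrow> z \<in> nb k" if "k < n" "z \<in> X" for k z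
      using that by (simp add: nb_def)
    have "x \<noteq> x'" using x by blast
    have xV: "x \<in> V" "x' \<in> V" using xX XV by auto
    show ?thesis
    proof (rule ccontr)
      assume "\<not> ?thesis"
      then have odd: "odd (b - a)" by blast
      have no: "\<not> leap V E X (segment P a (Suc b))"
        using no_leap_X[of a "Suc b"] a ab(1) b odd by (simp add: Suc_diff_le)
      show False
      proof (cases "b = Suc a")
        case True
        have "P ! a \<noteq> x" "P ! a \<noteq> x'" "P ! b \<noteq> x" "P ! b \<noteq> x'" "P ! a \<noteq> P ! b"
          "P ! a \<in> V" "P ! b \<in> V"
          using nth_notin[of a] nth_notin[of b] nth_eq[of a b] xX ab b by auto
        moreover have "E (P ! a) x" "\<not> E (P ! a) x'" "E (P ! b) x'" "\<not> E (P ! b) x" "E (P ! a) (P ! b)"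
          using iff[of a] iff[of b] adj[of a b] x xX ab(1) b True by auto
        moreover have "E x' (P ! b)" "\<not> E x (P ! b)" using calculation sym by blast+
        \<comment> \<open>\<open>P ! a\<close> sees \<open>x\<close> and misses \<open>x'\<close>,
          so the antipath visits \<open>x'\<close> first.\<close>
        ultimately have "is_antipath V E [P ! a, x', x, P ! b]"
          using xV \<open>x \<noteq> x'\<close> stable xX by (simp add: is_antipath_Cons_Cons[OF symp])
        moreover have "hd (segment P a (Suc b)) = P ! a" "last (segment P a (Suc b)) = P ! b"
          using hd_segment[of a "Suc b" P] last_segment[of a "Suc b" P] ab by auto
        ultimately have "leap V E X (segment P a (Suc b))"
          using xX True by (auto simp: leap_def intro!: exI[of _ "[x', x]"])
        then show False using no by simp
      next
        case False
        let ?R = "segment P a (Suc b)"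
        have R: "is_path V E ?R" "set ?R \<inter> (X \<union> Y) = {}"
          using segment_facts[of a "Suc b"] ab b by auto
        have in_nb: "x \<in> nb k \<longleftrightarrow> k = a" "x' \<in> nb k \<longleftrightarrow> k = b" if "a \<le> k" "k \<le> b" for k
          using x none[of k] that by (cases "k = a"; cases "k = b"; auto)+
        have bl: "butlast ?R = segment P a b" using butlast_segment[of P a "Suc b"] by simp
        have "is_path V E (?R @ [x'])"
        proof (rule is_path_snoc[OF symp R(1) xV(2)])
          show "E (last ?R) x'" using last_segment[of a "Suc b" P] ab b x xX iff by simp
          show "\<not> E u x'" if "u \<in> set (butlast ?R)" for u
            using that in_nb ab b iff xX by (auto simp: bl set_segment)
        qed (use R xX in auto)
        moreover have R_Cons: "?R = P ! a # segment P (Suc a) (Suc b)"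
          using ab by (simp add: segment_def upt_conv_Cons)
        moreover have "E x (P ! a)" using iff[of a x] x xX ab b sym by simp
        moreover have "\<not> E x z" if "z \<in> set (segment P (Suc a) (Suc b) @ [x'])" for z
        proof -
          from that have "z = x' \<or> (\<exists>k. a < k \<and> k \<le> b \<and> z = P ! k)"
            by (auto simp: set_segment) (metis Suc_le_lessD less_Suc_eq_le)
          then show ?thesis
          proof
            assume "z = x'"
            then show ?thesis using stable xX by simp
          next
            assume "\<exists>k. a < k \<and> k \<le> b \<and> z = P ! k"
            then obtain k where k: "a < k" "k \<le> b" "z = P ! k" by blast
            then have "\<not> E z x" using in_nb(1)[of k] iff[of k x] xX(1) b by simp
            then show ?thesis using sym by blast
          qed
        qed
        moreover have "x \<notin> set ?R" using R(2) xX by blast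
        ultimately have "is_path V E (x # ?R @ [x'])"
          using xV \<open>x \<noteq> x'\<close> by (simp add: is_path_Cons_Cons[OF symp])
        then have "leap V E X ?R" using xX False ab by (auto simp: leap_def)
        then show False using no by simp
      qed
    qed
  qed
  \<comment> \<open>\<open>labelled_gap\<close> serves twice: it is the hypothesis of the parity
    lemma, and at distance one it shows that the two ends share a neighbour.\<close>
  let ?L = "{k. k < n \<and> nb k \<noteq> {} \<and> nb (Suc k) \<noteq> {}}"
  have X0: "X \<noteq> {}" using card2 by auto
  have "even (card ?L) \<longleftrightarrow> even n"
    by (intro card_consecutive_parity) (use labelled_gap nb_0 nb_n X0 in auto)
  moreover have "?L = {k. k < n \<and> D k \<noteq> {}}"
  proof (intro Collect_cong conj_cong refl iffI)
    fix k assume "k < n" "nb k \<noteq> {} \<and> nb (Suc k) \<noteq> {}"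
    then have "nb k \<inter> nb (Suc k) \<noteq> {}" using labelled_gap[of k "Suc k"] by simp
    then show "D k \<noteq> {}" by (simp add: D_def)
  qed (auto simp: D_def)
  ultimately have oddD: "odd (card {k. k < n \<and> D k \<noteq> {}})" using odd_n by simp
  have finD: "finite (D k)" "D k \<subseteq> X" for k
    using nb_subset[of k] finite_subset[OF _ finX] by (auto simp: D_def)
  \<comment> \<open>Double counting: an edge whose ends have common neighbourhood \<open>D k\<close> is complete to
    \<open>2 ^ card (D k) - 1\<close> nonempty sets, an odd number unless \<open>D k\<close> is empty.\<close>
  let ?T = "{T. T \<subseteq> X \<and> T \<noteq> {}}"
  have finT: "finite ?T" using finX by simp
  have "(\<Sum>T\<in>?T. card (edges T)) = (\<Sum>T\<in>?T. \<Sum>k<n. if T \<subseteq> D k then 1 else 0)"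
  proof (intro sum.cong refl)
    fix T
    have "edges T = {k \<in> {..<n}. T \<subseteq> D k}" by (auto simp: edges_def D_def)
    then show "card (edges T) = (\<Sum>k<n. if T \<subseteq> D k then 1 else 0)"
      by (simp only: card_eq_sum sum.inter_filter[OF finite_lessThan])
  qed
  also have "\<dots> = (\<Sum>k<n. \<Sum>T\<in>?T. if T \<subseteq> D k then 1 else 0)" by (rule sum.swap)
  also have "\<dots> = (\<Sum>k<n. card {T \<in> ?T. T \<subseteq> D k})"
    by (simp only: card_eq_sum sum.inter_filter[OF finT])
  also have "\<dots> = (\<Sum>k<n. card (Pow (D k) - {{}}))"
    using finD by (intro sum.cong refl arg_cong[of _ _ card]) blast
  also have "\<dots> = (\<Sum>k<n. 2 ^ card (D k) - 1)"
    using finD by (intro sum.cong refl) (simp add: card_Diff_singleton card_Pow)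
  finally have count: "(\<Sum>T\<in>?T. card (edges T)) = (\<Sum>k<n. 2 ^ card (D k) - 1)" .
  have "odd (2 ^ card (D k) - 1 :: nat) \<longleftrightarrow> D k \<noteq> {}" for k
    using finD(1)[of k] by (cases "card (D k)") auto
  then have "{k \<in> {..<n}. odd (2 ^ card (D k) - 1 :: nat)} = {k. k < n \<and> D k \<noteq> {}}" by auto
  then have 1: "odd (\<Sum>k<n. 2 ^ card (D k) - 1 :: nat)" using oddD by (simp add: even_sum_iff)
  have "odd (card (edges T)) \<longleftrightarrow> T \<noteq> X" if "T \<in> ?T" for T
    using odd_card_edges[of T] ac[of T] edges_X that by (cases "T = X") auto
  then have "{T \<in> ?T. odd (card (edges T))} = Pow X - {{}, X}" by auto
  moreover have "card (Pow X - {{}, X}) = 2 ^ card X - 2"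
    using X0 finX by (subst card_Diff_subset) (auto simp: card_Pow)
  moreover have "even (2 ^ card X - 2 :: nat)" using card2 by simp
  ultimately have "even (\<Sum>T\<in>?T. card (edges T))" using finT by (simp add: even_sum_iff)
  then show False using 1 count by simp
qed

text \<open>The case split is on the parity of an antipath \<open>Q\<close> from \<open>x1\<close>
  to \<open>x2\<close> in \<open>X\<close>. With an odd number of vertices, the complete edges for
  \<open>X - {x1}\<close> and for \<open>X - {x2}\<close> are forced to opposite ends of
  \<open>P\<close>, too far apart. With an even number, those two families partition the edges
  complete to \<open>X - {x1, x2}\<close>, whose number would be even.\<close>

lemma not_nonstable:
  assumes uv: "u \<in> X" "v \<in> X" "E u v"
  shows False
proof -
  obtain x1 x2 where x: "x1 \<in> X" "x2 \<in> X" "E x1 x2"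
    and ac1: "anticonnected E (X - {x1})" and ac2: "anticonnected E (X - {x2})"
    and ac12: "anticonnected E (X - {x1, x2}) \<or> (\<exists>z\<in>X. \<not> E z x1 \<and> \<not> E z x2)"
    using anticonnected_nonstable_pair[OF symp finX Xac uv] by auto
  have x12: "x1 \<noteq> x2" using x(3) by auto
  have E21: "E x2 x1" using sym[OF x(3)] .
  \<comment> \<open>If \<open>X - {x1, x2}\<close> is not anticonnected, the common non-neighbour
    gives a \<open>Q\<close> with three vertices; so an even \<open>Q\<close> always comes with
    anticonnectivity.\<close>
  obtain Q where Q: "is_antipath V E Q" "hd Q = x1" "last Q = x2" "set Q \<subseteq> X"
    and Qz: "anticonnected E (X - {x1, x2}) \<or> odd (length Q)"
  proof (cases "anticonnected E (X - {x1, x2})")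
    case True
    have "(\<lambda>a b. a \<in> X \<and> b \<in> X \<and> a \<noteq> b \<and> \<not> E a b)\<^sup>*\<^sup>* x1 x2"
      using Xac x unfolding anticonnected_def by blast
    from induced_path_exists[OF symp_not[OF symp] this x(1) XV] show thesis
      using that True by (auto simp: is_antipath_iff)
  next
    case False
    then obtain z where z: "z \<in> X" "\<not> E z x1" "\<not> E z x2" using ac12 by blast
    then have "z \<noteq> x1" "z \<noteq> x2" using x(3) E21 by auto
    then have "is_antipath V E [x1, z, x2]"
      using z x x12 XV sym by (auto simp: is_antipath_Cons_Cons[OF symp])
    then show thesis using that[of "[x1, z, x2]"] z x by auto
  qed
  have Qne: "Q \<noteq> []" using Q(1) by (simp add: is_antipath_def)
  obtain A where A: "Q = x1 # A @ [x2]"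
    using Qne Q(2,3) x12
    by (metis append_butlast_last_id hd_Cons_tl last_ConsL last_tl)
  have Ane: "A \<noteq> []"
    using Q(1) x(3) unfolding A by (auto simp: is_antipath_Cons_Cons[OF symp])
  then have Qlen: "length Q \<ge> 3" unfolding A by (cases A) auto
  have AX: "set A \<subseteq> X - {x1, x2}" using Q(1,4) unfolding A is_antipath_def by auto
  let ?Z1 = "X - {x1}" and ?Z2 = "X - {x2}" and ?Z = "X - {x1, x2}"
  \<comment> \<open>\<open>S1\<close> and \<open>S2\<close> are the positions whose only
    non-neighbour in \<open>X\<close> is \<open>x1\<close> or \<open>x2\<close>, respectively.
    Besides them, only \<open>0\<close> and \<open>n\<close> are complete to \<open>X - {x1}\<close>
    or to \<open>X - {x2}\<close>.\<close>
  define S1 where "S1 = {k. k < n \<and> ?Z1 \<subseteq> nb k \<and> x1 \<notin> nb k}"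
  define S2 where "S2 = {k. k < n \<and> ?Z2 \<subseteq> nb k \<and> x2 \<notin> nb k}"
  have o1: "odd (card (edges ?Z1))" and o2: "odd (card (edges ?Z2))"
    using odd_card_edges ac1 ac2 x by auto
  have inner: "0 < k \<and> k < n" if "k \<in> S1 \<or> k \<in> S2" for k
    using that nb_0 x by (auto simp: S1_def S2_def intro!: gr0I)
  have full: "k = 0 \<or> k = n" if "X \<subseteq> nb k" "k \<le> n" for k
    using nb_neq[of k] nb_subset[of k] that by fastforce
  have cases1: "k \<in> S1 \<or> k = 0 \<or> k = n" if "?Z1 \<subseteq> nb k" "k \<le> n" for k
    using that full[of k] nb_n by (cases "k = n") (auto simp: S1_def)
  have cases2: "k \<in> S2 \<or> k = 0 \<or> k = n" if "?Z2 \<subseteq> nb k" "k \<le> n" for k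
    using that full[of k] nb_n by (cases "k = n") (auto simp: S2_def)
  have adj_nb: "E (P ! k) z \<longleftrightarrow> z \<in> nb k" if "k < n" "z \<in> X" for k z
    using that by (simp add: nb_def)
  have S1E: "E (P ! k) z \<longleftrightarrow> z \<noteq> x1" if "k \<in> S1" "z \<in> X" for k z
    using that adj_nb[of k z] by (auto simp: S1_def)
  have S2E: "E (P ! k) z \<longleftrightarrow> z \<noteq> x2" if "k \<in> S2" "z \<in> X" for k z
    using that adj_nb[of k z] by (auto simp: S2_def)
  have S12: "S1 \<inter> S2 = {}"
    using x12 x by (auto simp: S1_def S2_def)
  show False
  proof (cases "odd (length Q)")
    case True
    \<comment> \<open>Nonadjacent vertices from \<open>S1\<close> and \<open>S2\<close> would close \<open>Q\<close> to an odd antihole.\<close>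
    have all_adj: "i = Suc j \<or> j = Suc i" if "i \<in> S1" "j \<in> S2" for i j
    proof (rule ccontr)
      assume neg: "\<not> ?thesis"
      have ij: "i < n" "j < n" "i \<noteq> j" using that inner S12 by auto
      have nE: "\<not> E (P ! i) (P ! j)" "\<not> E (P ! j) (P ! i)" using adj ij neg by auto
      have p: "is_antipath V E (P ! i # x1 # A @ [x2])"
        using Q(1) AX S1E[OF that(1)] x x12 nth_notin[OF ij(1)]
        unfolding A by (auto simp: is_antipath_Cons_Cons[OF symp, of V "P ! i"])
      have "odd (length (P ! i # x1 # A @ [x2]))"
      proof (rule odd_length_antipath_closed_by_vertex[OF p])
        show "P ! j \<notin> set (P ! i # x1 # A @ [x2])"
          using nth_eq[of i j] ij nth_notin[OF ij(2)] AX x by auto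
        show "E (P ! j) u" if "u \<in> interior (P ! i # x1 # A @ [x2])" for u
          using that S2E[OF \<open>j \<in> S2\<close>] AX x x12 by (auto simp: interior_def)
      qed (use nth_notin[OF ij(2)] nE S2E[OF that(2), of x2] x in auto)
      then show False using True unfolding A by simp
    qed
    \<comment> \<open>Without consecutive positions in \<open>S\<close>, only the first edge and the
      virtual last edge can be \<open>Z\<close>-complete; an odd count leaves exactly one of
      them.\<close>
    have key: "Suc 0 \<in> S \<longleftrightarrow> n - 1 \<notin> S"
      if Z: "odd (card (edges Z))" and cs: "\<And>k. Z \<subseteq> nb k \<Longrightarrow> k \<le> n \<Longrightarrow> k \<in> S \<or> k = 0 \<or> k = n"
        and SZ: "\<And>k. k \<in> S \<Longrightarrow> 0 < k \<and> k < n \<and> Z \<subseteq> nb k" and ZX: "Z \<subseteq> X"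
        and no: "\<And>k. k \<in> S \<Longrightarrow> Suc k \<in> S \<Longrightarrow> False" for S Z
    proof -
      have sub: "k = 0 \<and> Suc 0 \<in> S \<or> k = n - 1 \<and> n - 1 \<in> S" if "k \<in> edges Z" for k
      proof -
        have k: "k < n" "k \<in> S \<or> k = 0" "Suc k \<in> S \<or> Suc k = n"
          using that cs[of k] cs[of "Suc k"] by (auto simp: edges_def)
        show ?thesis
        proof (cases "Suc k = n")
          case True
          then have "k = n - 1" "k \<noteq> 0" using len5 by auto
          then show ?thesis using k(2) by simp
        next
          case False
          then show ?thesis using no[of k] k by auto
        qed
      qed
      have e0: "0 \<in> edges Z \<longleftrightarrow> Suc 0 \<in> S"
        using sub[of 0] SZ[of "Suc 0"] nb_0 ZX len5 by (auto simp: edges_def)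
      have e1: "n - 1 \<in> edges Z \<longleftrightarrow> n - 1 \<in> S"
        using sub[of "n - 1"] SZ[of "n - 1"] nb_n ZX len5 by (auto simp: edges_def)
      have n1: "n - 1 \<noteq> 0" using len5 by simp
      have "edges Z \<subseteq> {0, n - 1}" using sub by blast
      then have "edges Z = {} \<or> edges Z = {0} \<or> edges Z = {n - 1} \<or> edges Z = {0, n - 1}" by blast
      moreover have "edges Z \<noteq> {}" "edges Z \<noteq> {0, n - 1}" using Z n1 by auto
      ultimately have "0 \<in> edges Z \<longleftrightarrow> n - 1 \<notin> edges Z" using n1 by blast
      then show ?thesis unfolding e0 e1 .
    qed
    have ne: "S1 \<noteq> {}" "S2 \<noteq> {}"
    proof -
      have "edges ?Z1 \<noteq> {}" "edges ?Z2 \<noteq> {}" using o1 o2 by auto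
      then obtain k l where k: "k \<in> edges ?Z1" and l: "l \<in> edges ?Z2" by blast
      have "k \<in> S1 \<or> Suc k \<in> S1" using k cases1[of k] cases1[of "Suc k"] len5
        by (auto simp: edges_def)
      then show "S1 \<noteq> {}" by auto
      have "l \<in> S2 \<or> Suc l \<in> S2" using l cases2[of l] cases2[of "Suc l"] len5
        by (auto simp: edges_def)
      then show "S2 \<noteq> {}" by auto
    qed
    \<comment> \<open>Consecutive vertices of a path have no common neighbour on it, so
      \<open>j\<close> keeps consecutive pairs out of \<open>S1\<close>, and \<open>i\<close> out of
      \<open>S2\<close>.\<close>
    then obtain i j where ij: "i \<in> S1" "j \<in> S2" by blast
    have "Suc 0 \<in> S1 \<longleftrightarrow> n - 1 \<notin> S1"
    proof (rule key[OF o1 cases1])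
      show "False" if "k \<in> S1" "Suc k \<in> S1" for k
        using all_adj[OF that(1) ij(2)] all_adj[OF that(2) ij(2)] by auto
      show "0 < k \<and> k < n \<and> ?Z1 \<subseteq> nb k" if "k \<in> S1" for k
        using that inner[of k] by (simp add: S1_def)
    qed blast+
    moreover have "Suc 0 \<in> S2 \<longleftrightarrow> n - 1 \<notin> S2"
    proof (rule key[OF o2 cases2])
      show "False" if "k \<in> S2" "Suc k \<in> S2" for k
        using all_adj[OF ij(1) that(1)] all_adj[OF ij(1) that(2)] by auto
      show "0 < k \<and> k < n \<and> ?Z2 \<subseteq> nb k" if "k \<in> S2" for k
        using that inner[of k] by (simp add: S2_def)
    qed blast+
    ultimately show False
      using S12 all_adj[of "Suc 0" "n - 1"] all_adj[of "n - 1" "Suc 0"] len5 by auto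
  next
    case False
    \<comment> \<open>A vertex complete to \<open>?Z\<close> but adjacent to neither \<open>x1\<close> nor \<open>x2\<close> would close \<open>Q\<close> to an odd
      antihole, and an edge from \<open>S1\<close> to \<open>S2\<close> would have \<open>Q\<close> as a leap.\<close>
    then have evQ: "even (length Q)" by simp
    then have acZ: "anticonnected E ?Z" using Qz by simp
    have noS12: "?Z1 \<subseteq> nb k \<or> ?Z2 \<subseteq> nb k" if "?Z \<subseteq> nb k" "k \<le> n" for k
    proof (rule ccontr)
      assume neg: "\<not> ?thesis"
      then have k: "k < n" using nb_n that(2) by (cases "k = n") auto
      have nx: "\<not> E (P ! k) x1" "\<not> E (P ! k) x2"
        using neg that x12 x adj_nb[OF k] by auto
      have "odd (length Q)"
      proof (rule odd_length_antipath_closed_by_vertex[OF Q(1) Qlen])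
        show "P ! k \<notin> set Q" using nth_notin[OF k] Q(4) by blast
        show "E (P ! k) u" if "u \<in> interior Q" for u
        proof -
          have "u \<in> set A" using that unfolding A by (simp add: interior_def)
          then show ?thesis using AX \<open>?Z \<subseteq> nb k\<close> adj_nb[OF k, of u] by auto
        qed
      qed (use nth_notin[OF k] nx Q(2,3) in auto)
      then show False using False by simp
    qed
    have no_switch: False
      if k: "0 < k" "Suc k < n" and B: "is_antipath V E (P ! k # B @ [P ! Suc k])"
        "set B \<subseteq> X" "even (length B)" for k B
    proof -
      have "leap V E X (segment P k (Suc (Suc k)))"
        using B hd_segment[of k "Suc (Suc k)" P] last_segment[of k "Suc (Suc k)" P]
        by (auto simp: leap_def)
      then show False using no_leap_X[of k "Suc (Suc k)"] k by simp
    qed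
    have ends: "is_antipath V E (P ! i # Q @ [P ! j])"
      if "i \<in> S1" "j \<in> S2" "i = Suc j \<or> j = Suc i" for i j
    proof -
      have ij: "i < n" "j < n" "i \<noteq> j" using that inner by auto
      have "is_path V (\<lambda>u v. \<not> E u v) (Q @ [P ! j])"
      proof (rule is_path_snoc[OF symp_not[OF symp]])
        show "\<not> \<not> E u (P ! j)" if "u \<in> set (butlast Q)" for u
        proof -
          have "u \<in> X" "u \<noteq> x2" using that AX x x12 unfolding A by auto
          then show ?thesis using S2E[OF \<open>j \<in> S2\<close>] sym by auto
        qed
      qed (use Q nth_notin[OF ij(2)] S2E[OF that(2), of x2] x sym in \<open>auto simp: is_antipath_iff\<close>)
      then have "is_antipath V E (x1 # A @ [x2, P ! j])" by (simp add: A is_antipath_iff)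
      then show ?thesis
        using AX S1E[OF that(1)] x x12 nth_notin[OF ij(1)] nth_eq[of i j] ij adj[of i j] that(3)
        unfolding A by (auto simp: is_antipath_Cons_Cons[OF symp, of V "P ! i"])
    qed
    have no12: False if "k \<in> S1" "Suc k \<in> S2" for k
      using no_switch[of k Q] ends[OF that] inner[of k] inner[of "Suc k"] that Q(4) evQ by auto
    have no21: False if "k \<in> S2" "Suc k \<in> S1" for k
    proof -
      have "is_antipath V E (rev (P ! Suc k # Q @ [P ! k]))"
        using ends[OF that(2,1)] by (subst is_antipath_rev_iff) simp
      then show False
        using no_switch[of k "rev Q"] inner[of k] inner[of "Suc k"] that Q(4) evQ by auto
    qed
    \<comment> \<open>An edge in neither of the two sets would join a position of \<open>S1\<close>
      to one of \<open>S2\<close>.\<close>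
    have "edges ?Z = edges ?Z1 \<union> edges ?Z2"
    proof
      show "edges ?Z1 \<union> edges ?Z2 \<subseteq> edges ?Z" by (auto simp: edges_def)
      show "edges ?Z \<subseteq> edges ?Z1 \<union> edges ?Z2"
      proof
        fix k assume "k \<in> edges ?Z"
        then have k: "k < n" "?Z \<subseteq> nb k" "?Z \<subseteq> nb (Suc k)" by (auto simp: edges_def)
        have "?Z1 \<subseteq> nb k \<and> ?Z1 \<subseteq> nb (Suc k) \<or> ?Z2 \<subseteq> nb k \<and> ?Z2 \<subseteq> nb (Suc k)"
        proof (rule ccontr)
          assume neg: "\<not> ?thesis"
          have kn: "k \<le> n" "Suc k \<le> n" using k(1) by simp_all
          have "\<not> X \<subseteq> nb k" "\<not> X \<subseteq> nb (Suc k)"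
            using neg noS12[OF k(2) kn(1)] noS12[OF k(3) kn(2)] by blast+
          then have "k \<noteq> 0" "k \<noteq> n" "Suc k \<noteq> n" using nb_0 nb_n by auto
          then have "?Z1 \<subseteq> nb k \<Longrightarrow> k \<in> S1" "?Z1 \<subseteq> nb (Suc k) \<Longrightarrow> Suc k \<in> S1"
            "?Z2 \<subseteq> nb k \<Longrightarrow> k \<in> S2" "?Z2 \<subseteq> nb (Suc k) \<Longrightarrow> Suc k \<in> S2"
            using cases1[of k] cases1[of "Suc k"] cases2[of k] cases2[of "Suc k"] k(1) by simp_all
          then have "k \<in> S1 \<and> Suc k \<in> S2 \<or> k \<in> S2 \<and> Suc k \<in> S1"
            using neg noS12[OF k(2)] noS12[OF k(3)] k(1) by (meson Suc_leI less_imp_le)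
          then show False using no12 no21 by blast
        qed
        then show "k \<in> edges ?Z1 \<union> edges ?Z2" using k(1) by (auto simp: edges_def)
      qed
    qed
    moreover have "edges ?Z1 \<inter> edges ?Z2 = {}"
    proof -
      \<comment> \<open>As \<open>x1\<close> and \<open>x2\<close> differ, \<open>?Z1\<close> and
        \<open>?Z2\<close> cover \<open>X\<close>.\<close>
      have "edges ?Z1 \<inter> edges ?Z2 \<subseteq> edges X" using x12 by (auto simp: edges_def)
      then show ?thesis using edges_X by simp
    qed
    ultimately have "even (card (edges ?Z))"
      using o1 o2 finite_edges by (simp add: card_Un_disjoint)
    moreover have "?Z \<subset> X" using x by auto
    ultimately show False using odd_card_edges acZ by blast
  qed
qed

lemma contradiction: False
  using not_stable not_nonstable by blast

end

section \<open>Short paths and the main induction\<close>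

context berge_graph
begin

text \<open>With \<open>P = [p, q, r]\<close>, the cycle \<open>q\<close>, \<open>A\<close>,
  \<open>r\<close>, \<open>p\<close>, \<open>B\<close> is an antihole, because \<open>p\<close> is
  complete to \<open>A\<close> and \<open>r\<close> to \<open>B\<close>. Its three further vertices
  make the parities of \<open>A\<close> and \<open>B\<close> differ.\<close>

lemma configuration_length_3:
  assumes cfg: "configuration X Y P" and len: "length P = 3"
  obtains A B where "set A \<subseteq> X" "set B \<subseteq> Y" "is_antipath V E (P ! 1 # A @ [P ! 2])"
    "is_antipath V E (P ! 0 # B @ [P ! 1])" "even (length A) \<longleftrightarrow> odd (length B)"
proof -
  obtain p q r where P: "P = [p, q, r]"
    using len by (metis length_0_conv length_Suc_conv numeral_3_eq_3)
  have path: "is_path V E [p, q, r]" and X: "X \<subseteq> V" "anticonnected E X" and Y: "Y \<subseteq> V" "anticonnected E Y"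
    and XY: "complete_to E X Y" and disj: "set P \<inter> (X \<union> Y) = {}"
    and cX: "X_complete E X p" "\<not> X_complete E X q" "\<not> X_complete E X r"
    and cY: "\<not> X_complete E Y p" "\<not> X_complete E Y q" "X_complete E Y r"
    using cfg by (auto simp: configuration_def P is_path_def)
  have pq: "E p q" "E q r" "\<not> E p r" "p \<noteq> r" "q \<noteq> r" "p \<noteq> q" "p \<in> V" "q \<in> V" "r \<in> V"
    using path by (auto simp: is_path_Cons_Cons[OF symp])
  obtain A where A: "set A \<subseteq> X" "A \<noteq> []" "is_antipath V E (q # A @ [r])"
    using antipath_through_anticonnected[OF X(2,1), of q r] disj pq cX by (auto simp: P)
  obtain B where B: "set B \<subseteq> Y" "B \<noteq> []" "is_antipath V E (p # B @ [q])"
    using antipath_through_anticonnected[OF Y(2,1), of p q] disj pq cY by (auto simp: P)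
  have "is_antipath V E (r # p # B @ [q])"
    using B(1,3) pq cY(3) disj sym
    by (auto simp: is_antipath_Cons_Cons[OF symp, of V r] X_complete_def P)
  then have "is_antipath V E (r # (p # B) @ [q])" by simp
  from even_length_antipath_cycle[OF A(3) this A(2)]
  have "even (length A + length (p # B))"
    using A(1) B(1) XY cX(1) sym by (force simp: complete_to_def X_complete_def)
  then have "even (length A) \<longleftrightarrow> odd (length B)" by simp
  with A B show thesis using that[of A B] by (simp add: P)
qed

lemma configuration_leap:
  assumes "configuration X Y P"
  shows "leap V E X (tl P) \<or> leap V E Y (butlast P)"
  using assms
proof (induction "card X + card Y" arbitrary: X Y P rule: less_induct)
  case less
  note cfg = less.prems
  have IH: "leap V E X' (tl P') \<or> leap V E Y' (butlast P')"
    if "configuration X' Y' P'" "card X' + card Y' < card X + card Y" for X' Y' P'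
    using less.hyps that by blast
  have len: "length P \<ge> 3" "odd (length P)" "P \<noteq> []" using cfg by (auto simp: configuration_def)
  have fin: "finite X" "finite Y" using cfg finite_subset_V by (auto simp: configuration_def)
  show ?case
  proof (cases "length P = 3")
    case True
    then obtain p q r where P: "P = [p, q, r]"
      by (metis length_0_conv length_Suc_conv numeral_3_eq_3)
    show ?thesis
      using configuration_length_3[OF cfg True] by (force simp: P leap_def)
  next
    case False
    then have len5: "length P \<ge> 5" using len by presburger
    have hl: "hd P \<in> set P" "last P \<in> set P" "hd P \<noteq> last P"
      using len cfg by (auto simp: configuration_def is_path_def hd_conv_nth last_conv_nth nth_eq_iff_index_eq)
    have X0: "X \<noteq> {}" and Y0: "Y \<noteq> {}"
      using hl cfg by (auto simp: configuration_def X_complete_def)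
    show ?thesis
    proof (rule ccontr)
      assume no: "\<not> ?thesis"
      consider "2 \<le> card X" | "2 \<le> card Y" | "card X = 1" "card Y = 1"
        using X0 Y0 fin by (metis One_nat_def Suc_1 Suc_leI card_gt_0_iff le_neq_implies_less)
      then show False
      proof cases
        case 1
        interpret leapless_configuration V E X Y P
          by unfold_locales (use no IH cfg len5 1 in auto)
        show False by (rule contradiction)
      next
        case 2
        have "\<not> leap V E Y (tl (rev P))"
        proof
          assume "leap V E Y (tl (rev P))"
          then have "leap V E Y (rev (tl (rev P)))"
            using len5 by (intro leap_rev) (auto simp flip: length_0_conv)
          then show False using no by (simp add: butlast_rev[symmetric])
        qed
        moreover have "\<not> leap V E X (butlast (rev P))"
        proof
          assume "leap V E X (butlast (rev P))"
          then have "leap V E X (rev (butlast (rev P)))"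
            using len5 by (intro leap_rev) (auto simp flip: length_0_conv)
          then show False using no by (simp add: butlast_rev)
        qed
        ultimately interpret leapless_configuration V E Y X "rev P"
          by unfold_locales (use IH configuration_rev[OF cfg] len5 2 in \<open>auto simp: add.commute\<close>)
        show False by (rule contradiction)
      next
        \<comment> \<open>With both sets singletons, \<open>P\<close>, \<open>y\<close> and
          \<open>x\<close> form a hole with two more vertices than \<open>P\<close>, an odd
          number.\<close>
        case 3
        then obtain x y where xy: "X = {x}" "Y = {y}" by (metis card_1_singletonE)
        have c: "is_path V E P" "E y x" "x \<in> V" "y \<in> V" "x \<notin> set P" "y \<notin> set P"
          "\<forall>p\<in>set P. E p x \<longleftrightarrow> p = hd P" "\<forall>p\<in>set P. E p y \<longleftrightarrow> p = last P"
          using cfg sym by (auto simp: configuration_def complete_to_def X_complete_def xy)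
        have bl: "u \<noteq> last P" "u \<in> set P" if "u \<in> set (butlast P)" for u
        proof -
          have "distinct (butlast P @ [last P])" using c(1) len(3) by (simp add: is_path_def)
          then show "u \<noteq> last P" using that by auto
        qed (use that in_set_butlastD in fast)
        have "is_path V E (P @ [y])"
          using c bl hl by (intro is_path_snoc[OF symp]) auto
        then have "odd (length (P @ [y]))"
        proof (rule odd_length_path_closed_by_vertex[of _ x])
          show "\<not> E x u" if "u \<in> interior (P @ [y])" for u
          proof -
            have "u \<in> set (tl P)" using that len(3) by (simp add: interior_def)
            moreover have "distinct (hd P # tl P)" using c(1) len(3) by (simp add: is_path_def)
            ultimately have "u \<in> set P" "u \<noteq> hd P" using list.set_sel(2)[OF len(3)] by auto
            then show ?thesis using c(7) sym by blast
          qed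
        qed (use c len hl sym in auto)
        then show False using len by simp
      qed
    qed
  qed
qed

end

section \<open>From leaps to the three outcomes\<close>

theorem theorem2p9:
  fixes V :: "'a set" and E :: "'a \<Rightarrow> 'a \<Rightarrow> bool"
    and X Y :: "'a set" and P :: "'a list"
  assumes G: "simple_graph V E"
    and berge: "berge V E"
    and XV: "X \<subseteq> V" and YV: "Y \<subseteq> V"
    and disj: "X \<inter> Y = {}" and Xne: "X \<noteq> {}" and Yne: "Y \<noteq> {}"
    and Xac: "anticonnected E X" and Yac: "anticonnected E Y"
    and XY: "complete_to E X Y"
    and Ppath: "is_path V E P" and Pout: "set P \<inter> (X \<union> Y) = {}"
    and Peven: "even (plen P)" and Ppos: "plen P > 0"
    and p1X: "X_complete E X (hd P)"
    and uniqX: "\<forall>p\<in>set P. X_complete E X p \<longrightarrow> p = hd P"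
    and pnY: "X_complete E Y (last P)"
    and uniqY: "\<forall>p\<in>set P. X_complete E Y p \<longrightarrow> p = last P"
  shows "((plen P \<ge> 4 \<and> (\<exists>x1\<in>X. \<exists>x2\<in>X. x1 \<noteq> x2 \<and> \<not> E x1 x2 \<and>
              is_path V E (x1 # tl P @ [x2])))
          \<or> (plen P \<ge> 4 \<and> (\<exists>y1\<in>Y. \<exists>y2\<in>Y. y1 \<noteq> y2 \<and> \<not> E y1 y2 \<and>
              is_path V E (y1 # butlast P @ [y2])))
          \<or> (plen P = 2 \<and>
              (\<exists>Q R. is_antipath V E Q \<and> hd Q = P!1 \<and> last Q = P!2 \<and> interior Q \<subseteq> X \<and>
                     is_antipath V E R \<and> hd R = P!0 \<and> last R = P!1 \<and> interior R \<subseteq> Y \<and>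
                     (odd (plen Q) \<noteq> odd (plen R)))))
         \<and> (\<not> balanced V E (set P - {hd P}) X \<or> \<not> balanced V E (set P - {last P}) Y)"
proof -
  interpret berge_graph V E by unfold_locales (fact G, fact berge)
  have len: "odd (length P)" "length P \<ge> 3" using Peven Ppos unfolding plen_def by presburger+
  then have Pne: "P \<noteq> []" by auto
  have cfg: "configuration X Y P"
    unfolding configuration_def using assms len Pne by auto
  have dist: "distinct P" using Ppath by (simp add: is_path_def)
  have tlP: "set (tl P) = set P - {hd P}" using dist Pne by (cases P) auto
  have blP: "set (butlast P) = set P - {last P}" using dist Pne by (cases P rule: rev_cases) auto
  have leap_ends: "x1 \<noteq> x2 \<and> \<not> E x1 x2" if "is_path V E (x1 # R @ [x2])" "R \<noteq> []" for x1 x2 R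
    using that is_path_snocD[of V E "x1 # R" x2 x1] by (auto simp: is_path_def)
  have unbalanced: "\<not> balanced V E (set R) Z"
    if p: "is_path V E (x1 # R @ [x2])" and "even (length R)" "R \<noteq> []" "x1 \<in> Z" "x2 \<in> Z" for x1 x2 R Z
  proof -
    let ?ps = "x1 # R @ [x2]"
    have "is_path V E ?ps \<and> hd ?ps \<in> Z \<and> last ?ps \<in> Z \<and> hd ?ps \<noteq> last ?ps \<and>
        \<not> E (hd ?ps) (last ?ps) \<and> interior ?ps \<subseteq> set R \<and> odd (plen ?ps)"
      using that leap_ends[OF p] by (simp add: interior_def plen_def)
    then show ?thesis unfolding balanced_def by blast
  qed
  have unbalanced': "\<not> balanced V E A Z"
    if "is_antipath V E (u # Q @ [v])" "E u v" "u \<in> A" "v \<in> A" "set Q \<subseteq> Z" "even (length Q)" for u v Q A Z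
  proof -
    let ?qs = "u # Q @ [v]"
    have "is_antipath V E ?qs \<and> hd ?qs \<in> A \<and> last ?qs \<in> A \<and> hd ?qs \<noteq> last ?qs \<and>
        E (hd ?qs) (last ?qs) \<and> interior ?qs \<subseteq> Z \<and> odd (plen ?qs)"
      using that by (auto simp: interior_def plen_def)
    then show ?thesis unfolding balanced_def by blast
  qed
  show ?thesis
  proof (cases "length P = 3")
    case True
    then obtain A B where AB: "set A \<subseteq> X" "set B \<subseteq> Y" "is_antipath V E (P ! 1 # A @ [P ! 2])"
      "is_antipath V E (P ! 0 # B @ [P ! 1])" "even (length A) \<longleftrightarrow> odd (length B)"
      using configuration_length_3[OF cfg] by blast
    have adj: "E (P ! 1) (P ! 2)" "E (P ! 0) (P ! 1)" using Ppath True by (auto simp: is_path_def)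
    have mem: "P ! 1 \<in> set (tl P)" "P ! 2 \<in> set (tl P)" "P ! 0 \<in> set (butlast P)" "P ! 1 \<in> set (butlast P)"
    proof -
      obtain p q r where "P = [p, q, r]"
        using True by (metis length_0_conv length_Suc_conv numeral_3_eq_3)
      then show "P ! 1 \<in> set (tl P)" "P ! 2 \<in> set (tl P)" "P ! 0 \<in> set (butlast P)"
        "P ! 1 \<in> set (butlast P)" by simp_all
    qed
    \<comment> \<open>Exactly one of the two antipaths is odd; its adjacent ends lie in the tail of
      \<open>P\<close> if it runs through \<open>X\<close>, and in \<open>butlast P\<close> if it
      runs through \<open>Y\<close>.\<close>
    have "\<not> balanced V E (set P - {hd P}) X \<or> \<not> balanced V E (set P - {last P}) Y"
      using unbalanced'[OF AB(3) adj(1), of "set (tl P)" X] unbalanced'[OF AB(4) adj(2), of "set (butlast P)" Y]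
        mem AB by (cases "even (length A)") (auto simp: tlP blP)
    moreover have "\<exists>Q R. is_antipath V E Q \<and> hd Q = P!1 \<and> last Q = P!2 \<and> interior Q \<subseteq> X \<and>
                     is_antipath V E R \<and> hd R = P!0 \<and> last R = P!1 \<and> interior R \<subseteq> Y \<and>
                     (odd (plen Q) \<noteq> odd (plen R))"
      using AB by (intro exI[of _ "P ! 1 # A @ [P ! 2]"] exI[of _ "P ! 0 # B @ [P ! 1]"])
        (simp add: interior_def plen_def)
    ultimately show ?thesis using True by (simp add: plen_def)
  next
    case False
    then have len5: "length P \<ge> 5" "plen P \<ge> 4" using len by (auto simp: plen_def) presburger+
    have ne: "tl P \<noteq> []" "butlast P \<noteq> []" "length (tl P) \<noteq> 2" "length (butlast P) \<noteq> 2"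
      using len5 by (auto simp flip: length_0_conv)
    have ev: "even (length (tl P))" "even (length (butlast P))" using len by auto
    from configuration_leap[OF cfg] show ?thesis
    proof
      assume "leap V E X (tl P)"
      then obtain x1 x2 where x: "x1 \<in> X" "x2 \<in> X" "is_path V E (x1 # tl P @ [x2])"
        using ne by (auto simp: leap_def)
      then show ?thesis
        using unbalanced[OF x(3) ev(1) ne(1) x(1,2)] leap_ends[OF x(3) ne(1)] len5(2) tlP by auto
    next
      assume "leap V E Y (butlast P)"
      then obtain x1 x2 where x: "x1 \<in> Y" "x2 \<in> Y" "is_path V E (x1 # butlast P @ [x2])"
        using ne by (auto simp: leap_def)
      then show ?thesis
        using unbalanced[OF x(3) ev(2) ne(2) x(1,2)] leap_ends[OF x(3) ne(2)] len5(2) blP by auto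
    qed
  qed
qed

end
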